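(* Let $\mathcal{T}^\ell$ represent $\ell$ iterations of the accelerated projected gradient method. The closed-loop system $$z_k=\mathcal{T}^\ell(z_{k-1},x_k),\qquad x_{k+1}=Ax_k+B\Xi z_k$$ is asymptotically stable if $\ell>\max(\ell_a^*,\bar\ell)$, where $$\ell_a^*=1-\frac{2\log\left(\kappa(H)^{1/2}(1+\zeta_a\gamma_1)\right)}{\log\left(1-\kappa(H)^{-1/2}\right)},\qquad \bar\ell=1-\frac{\log(\kappa(H))}{\log(1-1/\sqrt{\kappa(H)})},$$ $\gamma_1=\beta/(1-\beta)$ with $\beta=\sqrt{1-\lambda_W^-(Q)}$, and $\zeta_a=2\,\|H^{-1/2}GP^{-1/2}\|\,\|W^{1/2}\bar BH^{-1/2}\|$ with $\bar B=B\Xi$.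
   Context: Notation: $\mathbb{S}_{++}^d$ (resp. $\mathbb{S}_+^d$) is the set of symmetric positive definite (resp. semidefinite) $d\times d$ real matrices; $\|x\|_M=\sqrt{x^TMx}$; $\|\cdot\|$ without subscript is the Euclidean norm (induced $2$-norm for matrices); $\lambda^-(H),\lambda^+(H)$ are the minimum and maximum eigenvalues, $\kappa(H)=\lambda^+(H)/\lambda^-(H)$; for $W\in\mathbb{S}_{++}^n$, $M\in\mathbb{S}_+^n$, $\lambda_W^-(M)$ is the minimum eigenvalue of $W^{-1/2}MW^{-1/2}$; $(x,y)$ denotes the stacked vector. The iteration count $\ell$ is a positive integer. Setting: $n,m,N\ge1$ are integers, $A\in\mathbb{R}^{n\times n}$, $B\in\mathbb{R}^{n\times m}$. Standing assumptions: (1) $(A,B)$ is stabilizable, $R\in\mathbb{S}_{++}^m$, $Q\in\mathbb{S}_{++}^n$, and $P\in\mathbb{S}_{++}^n$ satisfies $P=Q+A^TPA-(A^TPB)(R+B^TPB)^{-1}(B^TPA)$; (2) $\mathcal{U}\subseteq\mathbb{R}^m$ is closed, convex and contains the origin in its interior. Let $\hat A\in\mathbb{R}^{(N+1)n\times n}$ be the block column with blocks $I,A,\dots,A^N$; let $\hat B\in\mathbb{R}^{(N+1)n\times Nm}$ be the block matrix whose block $(i,j)$, $i=0,\dots,N$, $j=0,\dots,N-1$, is $A^{i-1-j}B$ if $j\le i-1$ and $0$ otherwise; $\hat H=\mathrm{blkdiag}(I_N\otimes Q,\,P)$. Set $H=\hat B^T\hat H\hat B+I_N\otimes R$, $G=\hat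 B^T\hat H\hat A$, $W=\hat A^T\hat H\hat A=\sum_{k=0}^{N-1}(A^k)^TQA^k+(A^N)^TPA^N$, $M=\begin{bmatrix}H&G\\ G^T&W\end{bmatrix}$. Let $\mathcal{Z}=\mathcal{U}\times\cdots\times\mathcal{U}$ ($N$ copies) and $f(z,x)=\|(z,x)\|_M^2$. $\Xi=[1\ 0\ \cdots\ 0]\otimes I_m\in\mathbb{R}^{m\times Nm}$ selects the first input block. Accelerated projected gradient method: given $z\in\mathcal{Z}$, $x\in\mathbb{R}^n$ and an integer $\ell>0$, put $\mathsf{m}=2\lambda^-(H)$, $L=2\lambda^+(H)$, $\kappa=L/\mathsf{m}$, $\theta_0=1$, $\theta_{-1}=0$, $z_0=v_0=z$, and for $k=0,\dots,\ell-1$: $\gamma_k=\theta_{k-1}^2L$, $y_k=z_k+\frac{\theta_k\gamma_k}{\gamma_k+\mathsf{m}\theta_k}(v_k-z_k)$, $z_{k+1}=\Pi_{\mathcal{Z}}[y_k-L^{-1}\nabla_zf(y_k,x)]$, $v_{k+1}=z_k+\theta_k^{-1}(z_{k+1}-z_k)$, $\zeta_k=\theta_k^2-\kappa^{-1}$, $\theta_{k+1}=\frac{\zeta_k}{2}\left(\sqrt{1+4\theta_k^2/\zeta_k^2}-1\right)$. Here $\Pi_{\mathcal{Z}}$ is Euclidean projection onto $\mathcal{Z}$. The output is $\mathcal{T}^\ell(z,x)=z_\ell$ (the indices and the $\gamma_k,\zeta_k$ inside the algorithm are internal to each call and unrelated to the constants in the claim). Asymptotic stability of the closed-loop system refers to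 the origin $(x,z)=(0,0)$, with initial conditions $(x_0,z_0)$ (the algorithm takes inputs $z\in\mathcal{Z}$). *)

theory Defs
  imports "HOL-Analysis.Analysis"
begin

section \<open>Matrices\<close>

(* (^) on the type real^'n^'n is the entrywise power, hence a separate definition. *)
primrec mat_pow :: "real^'n^'n \<Rightarrow> nat \<Rightarrow> real^'n^'n" where
  "mat_pow A 0 = mat 1"
| "mat_pow A (Suc k) = A ** mat_pow A k"

definition pos_def :: "real^'n^'n \<Rightarrow> bool" where
  "pos_def M \<longleftrightarrow> transpose M = M \<and> (\<forall>x. x \<noteq> 0 \<longrightarrow> x \<bullet> (M *v x) > 0)"

definition pos_semidef :: "real^'n^'n \<Rightarrow> bool" where
  "pos_semidef M \<longleftrightarrow> transpose M = M \<and> (\<forall>x. x \<bullet> (M *v x) \<ge> 0)"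

definition mat_sqrt :: "real^'n^'n \<Rightarrow> real^'n^'n" where
  "mat_sqrt M = (THE S. pos_semidef S \<and> S ** S = M)"

abbreviation inv_sqrt :: "real^'n^'n \<Rightarrow> real^'n^'n" where
  "inv_sqrt M \<equiv> matrix_inv (mat_sqrt M)"

definition eigvals :: "'a::field^'n^'n \<Rightarrow> 'a set" where
  "eigvals M = {c. \<exists>v. v \<noteq> 0 \<and> M *v v = c *s v}"

(* Meaningful for symmetric M, where eigvals M is finite and nonempty. *)
definition lam_min :: "real^'n^'n \<Rightarrow> real" where
  "lam_min M = Min (eigvals M)"

definition lam_max :: "real^'n^'n \<Rightarrow> real" where
  "lam_max M = Max (eigvals M)"

definition cond_num :: "real^'n^'n \<Rightarrow> real" where
  "cond_num M = lam_max M / lam_min M"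

definition lam_min_wrt :: "real^'n^'n \<Rightarrow> real^'n^'n \<Rightarrow> real" where
  "lam_min_wrt W M = lam_min (inv_sqrt W ** M ** inv_sqrt W)"

definition mat_norm :: "real^'n^'m \<Rightarrow> real" where
  "mat_norm M = onorm ((*v) M)"

definition weighted_norm :: "real^'n^'n \<Rightarrow> real^'n \<Rightarrow> real" where
  "weighted_norm M x = sqrt (x \<bullet> (M *v x))"

definition stabilizable :: "real^'n^'n \<Rightarrow> real^'m^'n \<Rightarrow> bool" where
  "stabilizable A B \<longleftrightarrow>
     (\<exists>K :: real^'n^'m. \<forall>c \<in> eigvals (map_matrix complex_of_real (A + B ** K)). cmod c < 1)"


section \<open>The condensed optimal control problem\<close>

(* The horizon N is CARD('h) for a finite linearly ordered type 'h, whose elements are the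
   input stages 0,...,N-1; the state stages 0,...,N are 'h option, with None as stage N.
   Block vectors and matrices are indexed by pairs (stage, component). *)

definition input_stage :: "'h::{finite,linorder} \<Rightarrow> nat" where
  "input_stage j = card {i. i < j}"

definition state_stage :: "'h::{finite,linorder} option \<Rightarrow> nat" where
  "state_stage s = (case s of Some i \<Rightarrow> input_stage i | None \<Rightarrow> CARD('h))"

definition A_hat :: "real^'n^'n \<Rightarrow> real^'n^('h::{finite,linorder} option \<times> 'n)" where
  "A_hat A = (\<chi> r c. mat_pow A (state_stage (fst r)) $ snd r $ c)"

definition B_hat ::
  "real^'n^'n \<Rightarrow> real^'m^'n \<Rightarrow> real^('h::{finite,linorder} \<times> 'm)^('h option \<times> 'n)" where
  "B_hat A B = (\<chi> r c.
     let i = state_stage (fst r); j = input_stage (fst c)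
     in if j < i then (mat_pow A (i - 1 - j) ** B) $ snd r $ snd c else 0)"

definition H_hat ::
  "real^'n^'n \<Rightarrow> real^'n^'n \<Rightarrow> real^('h::{finite,linorder} option \<times> 'n)^('h option \<times> 'n)" where
  "H_hat Q P = (\<chi> r c.
     if fst r = fst c
     then (case fst r of Some _ \<Rightarrow> Q $ snd r $ snd c | None \<Rightarrow> P $ snd r $ snd c)
     else 0)"

definition kron :: "real^'b^'a \<Rightarrow> real^'d^'c \<Rightarrow> real^('b \<times> 'd)^('a \<times> 'c)" where
  "kron X Y = (\<chi> r c. X $ fst r $ fst c * Y $ snd r $ snd c)"

definition H_mat :: "real^'n^'n \<Rightarrow> real^'m^'n \<Rightarrow> real^'n^'n \<Rightarrow> real^'m^'m \<Rightarrow> real^'n^'n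
    \<Rightarrow> real^('h::{finite,linorder} \<times> 'm)^('h \<times> 'm)" where
  "H_mat A B Q R P = transpose (B_hat A B) ** H_hat Q P ** B_hat A B + kron (mat 1) R"

definition G_mat :: "real^'n^'n \<Rightarrow> real^'m^'n \<Rightarrow> real^'n^'n \<Rightarrow> real^'n^'n
    \<Rightarrow> real^'n^('h::{finite,linorder} \<times> 'm)" where
  "G_mat A B Q P = transpose (B_hat A B) ** H_hat Q P ** A_hat A"

definition W_mat :: "'h::{finite,linorder} itself \<Rightarrow> real^'n^'n \<Rightarrow> real^'n^'n \<Rightarrow> real^'n^'n
    \<Rightarrow> real^'n^'n" where
  "W_mat _ A Q P =
     transpose (A_hat A :: real^'n^('h option \<times> 'n)) ** H_hat Q P ** A_hat A"

definition stack :: "real^'p \<Rightarrow> real^'n \<Rightarrow> real^('p + 'n)" where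
  "stack z x = (\<chi> i. case i of Inl a \<Rightarrow> z $ a | Inr b \<Rightarrow> x $ b)"

definition M_mat :: "real^'p^'p \<Rightarrow> real^'n^'p \<Rightarrow> real^'n^'n \<Rightarrow> real^('p + 'n)^('p + 'n)" where
  "M_mat H G W = (\<chi> r c. case (r, c) of
       (Inl a, Inl b) \<Rightarrow> H $ a $ b
     | (Inl a, Inr b) \<Rightarrow> G $ a $ b
     | (Inr a, Inl b) \<Rightarrow> transpose G $ a $ b
     | (Inr a, Inr b) \<Rightarrow> W $ a $ b)"

definition cost :: "real^'p^'p \<Rightarrow> real^'n^'p \<Rightarrow> real^'n^'n \<Rightarrow> real^'p \<Rightarrow> real^'n \<Rightarrow> real" where
  "cost H G W z x = (weighted_norm (M_mat H G W) (stack z x))\<^sup>2"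

definition input_seqs :: "(real^'m) set \<Rightarrow> (real^('h::{finite,linorder} \<times> 'm)) set" where
  "input_seqs U = {z. \<forall>j. (\<chi> a. z $ (j, a)) \<in> U}"

definition first_block :: "real^('h::{finite,linorder} \<times> 'm)^'m" where
  "first_block = (\<chi> a c. if input_stage (fst c) = 0 \<and> snd c = a then 1 else 0)"


section \<open>Accelerated projected gradient method\<close>

definition grad :: "('a::real_inner \<Rightarrow> real) \<Rightarrow> 'a \<Rightarrow> 'a" where
  "grad g y = (THE D. GDERIV g y :> D)"

(* \<zeta> vanishes only for \<kappa> = 1. Division by zero then gives \<theta> = 0 from index 1 on, but this
   has no influence on the method: for \<kappa> = 1 the first step already returns the minimizer
   and all later projected gradient steps are exact as well. *)
primrec apg_theta :: "real \<Rightarrow> nat \<Rightarrow> real" where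
  "apg_theta \<kappa> 0 = 1"
| "apg_theta \<kappa> (Suc k) =
     (let \<theta> = apg_theta \<kappa> k; \<zeta> = \<theta>\<^sup>2 - inverse \<kappa>
      in \<zeta> / 2 * (sqrt (1 + 4 * \<theta>\<^sup>2 / \<zeta>\<^sup>2) - 1))"

(* \<gamma> at index k, with the convention that \<theta> is 0 at index -1 *)
definition apg_gamma :: "real \<Rightarrow> real \<Rightarrow> nat \<Rightarrow> real" where
  "apg_gamma \<mu> L k = (case k of 0 \<Rightarrow> 0 | Suc j \<Rightarrow> (apg_theta (L / \<mu>) j)\<^sup>2) * L"

(* The pair (z, v) after k iterations, for strong convexity constant \<mu>, smoothness constant L,
   feasible set Z, objective g and starting point z0. *)
primrec apg_iter :: "real \<Rightarrow> real \<Rightarrow> 'a::euclidean_space set \<Rightarrow> ('a \<Rightarrow> real) \<Rightarrow> 'a \<Rightarrow> nat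
    \<Rightarrow> 'a \<times> 'a" where
  "apg_iter \<mu> L Z g z0 0 = (z0, z0)"
| "apg_iter \<mu> L Z g z0 (Suc k) =
     (let (z, v) = apg_iter \<mu> L Z g z0 k;
          \<theta> = apg_theta (L / \<mu>) k;
          \<gamma> = apg_gamma \<mu> L k;
          y = z + (\<theta> * \<gamma> / (\<gamma> + \<mu> * \<theta>)) *\<^sub>R (v - z);
          z' = closest_point Z (y - inverse L *\<^sub>R grad g y)
      in (z', z + inverse \<theta> *\<^sub>R (z' - z)))"

definition apg :: "real^'p^'p \<Rightarrow> real^'n^'p \<Rightarrow> real^'n^'n \<Rightarrow> (real^'p) set \<Rightarrow> nat
    \<Rightarrow> real^'p \<Rightarrow> real^'n \<Rightarrow> real^'p" where
  "apg H G W Z l z x =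
     fst (apg_iter (2 * lam_min H) (2 * lam_max H) Z (\<lambda>z'. cost H G W z' x) z l)"


section \<open>Closed loop and stability\<close>

(* One step (x_k, z_k) \<mapsto> (x_(k+1), z_(k+1)); T is evaluated at the new state. *)
definition closed_loop :: "real^'n^'n \<Rightarrow> real^'p^'n \<Rightarrow> (real^'p \<Rightarrow> real^'n \<Rightarrow> real^'p)
    \<Rightarrow> (real^'n) \<times> (real^'p) \<Rightarrow> (real^'n) \<times> (real^'p)" where
  "closed_loop A Bbar T = (\<lambda>(x, z). let x' = A *v x + Bbar *v z in (x', T z x'))"

(* Lyapunov stability and local attractivity of p for s_(k+1) = F s_k with initial
   conditions in D; this entails F p = p. *)
definition asymptotically_stable :: "('s::metric_space \<Rightarrow> 's) \<Rightarrow> 's set \<Rightarrow> 's \<Rightarrow> bool" where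
  "asymptotically_stable F D p \<longleftrightarrow>
     p \<in> D \<and>
     (\<forall>\<epsilon>>0. \<exists>\<delta>>0. \<forall>s\<in>D. dist s p < \<delta> \<longrightarrow> (\<forall>k. dist ((F ^^ k) s) p < \<epsilon>)) \<and>
     (\<exists>\<delta>>0. \<forall>s\<in>D. dist s p < \<delta> \<longrightarrow> (\<lambda>k. (F ^^ k) s) \<longlonglongrightarrow> p)"

end

theory Submission
  imports Defs
begin

text \<open>
  Write \<open>k x = H\<^sup>-\<^sup>1 G x\<close>, so that \<open>- k x\<close> is the unconstrained minimizer of the cost. It lies in
  the interior of the feasible set for small \<open>x\<close>, hence near the origin it is also the constrained
  minimizer, and the closed loop couples two quantities: the state in the norm \<open>s = |x|\<^sub>P\<close> and the
  suboptimality \<open>e = |z + k x|\<^sub>H\<close>.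

  \<^bold>\<open>The plant.\<close> Completing squares with the Riccati equation along a trajectory shows that the cost
  of \<open>z\<close> is at least \<open>|x|\<^sub>P\<^sup>2\<close>, with equality for the linear-quadratic regulator, and at least
  \<open>|x|\<^sub>Q\<^sup>2 + |x'|\<^sub>P\<^sup>2\<close>, where \<open>x'\<close> is the successor state (\<open>value_function_bounds\<close>). Since the cost
  is quadratic, it therefore equals \<open>|x|\<^sub>P\<^sup>2 + |z + k x|\<^sub>H\<^sup>2\<close>. With \<open>d = |k x|\<^sub>H\<close> and with \<open>X\<close> the
  \<open>P\<close>-norm of the successor under the optimal input, this yields
  \<open>X\<^sup>2 + (1 - \<beta>\<^sup>2) d\<^sup>2 \<le> \<beta>\<^sup>2 s\<^sup>2\<close>, and a suboptimal input moves the successor by at most \<open>\<sigma> e\<close> with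
  \<open>\<sigma> \<le> 1\<close>. Moreover \<open>d \<le> a s\<close>, where \<open>2 a \<sigma>\<close> is at most the constant \<open>\<zeta>\<^sub>a\<close> of the theorem.

  \<^bold>\<open>The optimizer.\<close> If \<open>\<eta>\<close> is its contraction factor, the new suboptimality is at most
  \<open>\<eta> (e + d + d')\<close>, where \<open>d'\<close> belongs to the successor state.

  \<^bold>\<open>The coupling.\<close> Estimating \<open>X \<le> \<beta> s\<close> and \<open>d \<le> a s\<close> separately requires
  \<open>\<eta> (1 + 2 a \<sigma> / (1 - \<beta>)) < 1\<close>, while the bound on the iteration count only says
  \<open>\<eta>\<^sub>0 (1 + 2 a \<sigma> \<beta> / (1 - \<beta>)) < 1\<close> with \<open>\<eta>\<^sub>0\<^sup>2 = \<kappa> (1 - 1/\<surd>\<kappa>)\<^sup>l\<^sup>-\<^sup>1\<close>, which has an additional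
  factor \<open>\<beta>\<close>. Two gains close this gap. First, \<open>\<eta>\<^sup>2 \<le> \<eta>\<^sub>0\<^sup>2 / 2\<close>: the initial gradient step gains
  a factor \<open>1 - 1/\<kappa>\<close>, and the first accelerated step contracts faster than the asymptotic rate
  (\<open>apg_linear_rate\<close>). Second, \<open>X\<close> and \<open>d\<close> cannot both be extremal, because their squares are bounded
  jointly. It then suffices to prove an inequality between real numbers in which the constant
  \<open>7/5 < \<surd>2\<close> is available (\<open>small_gain\<close>), and \<open>r s + e / \<eta>\<close> is a local Lyapunov function for a
  suitable weight \<open>r\<close> (\<open>local_closed_loop_stability\<close>).
\<close>

section \<open>Symmetric matrices: spectral theorem and square roots\<close>

lemma inner_transpose_mult:
  fixes A :: "real^'n^'m"
  shows "(transpose A *v x) \<bullet> y = x \<bullet> (A *v y)"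
  by (simp add: dot_lmul_matrix)

lemma inner_transpose_mult':
  fixes A :: "real^'n^'m"
  shows "x \<bullet> (transpose A *v y) = (A *v x) \<bullet> y"
  by (metis inner_transpose_mult inner_commute)

lemma inner_mult_sym:
  fixes M :: "real^'n^'n"
  assumes "transpose M = M"
  shows "(M *v x) \<bullet> y = x \<bullet> (M *v y)"
  using inner_transpose_mult[of M x y] assms by simp

lemma symmetricI:
  fixes M :: "real^'n^'n"
  assumes "\<And>x y. (M *v x) \<bullet> y = x \<bullet> (M *v y)"
  shows "transpose M = M"
proof -
  have "transpose M *v x = M *v x" for x
  proof (rule vector_eq_rdot[THEN iffD1], intro allI)
    fix z show "(transpose M *v x) \<bullet> z = (M *v x) \<bullet> z"
      by (simp only: inner_transpose_mult assms)
  qed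
  then show ?thesis by (simp add: matrix_eq)
qed

text \<open>A zero \<open>v\<close> of a nonnegative quadratic form is a minimum, so its directional derivative along
  \<open>w = N v\<close>, which is \<open>2 |w|\<^sup>2\<close>, vanishes. The form is only nonnegative on \<open>V\<close>, but \<open>w\<close> is in \<open>V\<close>.\<close>
lemma nonneg_form_zero_imp_kernel:
  fixes N :: "real^'n^'n"
  assumes sym: "transpose N = N" and V: "subspace V"
    and inv: "\<And>x. x \<in> V \<Longrightarrow> N *v x \<in> V"
    and psd: "\<And>x. x \<in> V \<Longrightarrow> x \<bullet> (N *v x) \<ge> 0"
    and v: "v \<in> V" "v \<bullet> (N *v v) = 0"
  shows "N *v v = 0"
proof -
  define w where "w = N *v v"
  define c where "c = w \<bullet> (N *v w)"
  have w: "w \<in> V" using inv v by (simp add: w_def)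
  have c: "c \<ge> 0" unfolding c_def using psd w by simp
  have "0 \<le> (v - t *\<^sub>R w) \<bullet> (N *v (v - t *\<^sub>R w))" for t
    using psd V v w by (meson subspace_diff subspace_scale)
  moreover have "(v - t *\<^sub>R w) \<bullet> (N *v (v - t *\<^sub>R w)) = t\<^sup>2 * c - 2 * t * (w \<bullet> w)" for t
  proof -
    have 1: "N *v (v - t *\<^sub>R w) = w - t *\<^sub>R (N *v w)"
      by (simp add: w_def matrix_vector_mult_diff_distrib matrix_vector_mult_scaleR)
    have 2: "v \<bullet> (N *v w) = w \<bullet> w"
      using inner_mult_sym[OF sym, of v w] by (simp add: w_def)
    have 3: "v \<bullet> w = 0" using v by (simp add: w_def)
    show ?thesis unfolding 1
      by (simp add: inner_diff_left inner_diff_right 2 3 c_def power2_eq_square inner_commute algebra_simps)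
  qed
  ultimately have ineq: "2 * t * (w \<bullet> w) \<le> t\<^sup>2 * c" for t by (metis diff_ge_0_iff_ge)
  have "w \<bullet> w \<le> 0"
  proof (rule ccontr)
    assume "\<not> w \<bullet> w \<le> 0"
    then have pos: "w \<bullet> w > 0" by (simp only: not_le)
    \<comment> \<open>small enough for the linear term to dominate the quadratic one; \<open>c + 1\<close> avoids a zero denominator\<close>
    define t where "t = (w \<bullet> w) / (c + 1)"
    have t: "t > 0" using pos c by (simp add: t_def)
    have "2 * (w \<bullet> w) \<le> t * c" using ineq[of t] t by (simp add: power2_eq_square)
    also have "\<dots> \<le> w \<bullet> w" using c pos by (simp add: t_def field_simps)
    finally show False using pos by simp
  qed
  then show ?thesis unfolding w_def by (metis inner_ge_zero inner_eq_zero_iff antisym)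
qed

text \<open>The minimum of the Rayleigh quotient over an invariant subspace is attained by compactness,
  and there the shifted matrix has a vanishing nonnegative form.\<close>
lemma eigenvector_in_invariant_subspace:
  fixes M :: "real^'n^'n"
  assumes sym: "transpose M = M" and V: "subspace V" and nz: "V \<noteq> {0}"
    and inv: "\<And>x. x \<in> V \<Longrightarrow> M *v x \<in> V"
  obtains v c where "v \<in> V" "norm v = 1" "M *v v = c *\<^sub>R v"
proof -
  let ?K = "V \<inter> sphere 0 1"
  have "compact ?K" using V by (simp add: closed_subspace closed_Int_compact)
  moreover obtain u where u: "u \<in> V" "u \<noteq> 0" using nz V subspace_0 by blast
  then have "(1 / norm u) *\<^sub>R u \<in> ?K" using V by (simp add: subspace_scale)
  then have "?K \<noteq> {}" by blast
  moreover have "continuous_on ?K (\<lambda>x. x \<bullet> (M *v x))"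
    by (intro continuous_intros)
  ultimately obtain v where v: "v \<in> ?K" and vmin: "\<And>x. x \<in> ?K \<Longrightarrow> v \<bullet> (M *v v) \<le> x \<bullet> (M *v x)"
    using continuous_attains_inf[of ?K] by blast
  define c where "c = v \<bullet> (M *v v)"
  define N where "N = M - c *\<^sub>R mat 1"
  have Nv: "N *v x = M *v x - c *\<^sub>R x" for x
    by (simp add: N_def matrix_vector_mult_diff_rdistrib flip: scaleR_matrix_vector_assoc)
  have "transpose N = N" by (rule symmetricI) (simp add: Nv inner_diff_left inner_diff_right inner_mult_sym[OF sym])
  moreover have "N *v x \<in> V" if "x \<in> V" for x
    using that V inv by (simp add: Nv subspace_diff subspace_scale)
  moreover have "x \<bullet> (N *v x) \<ge> 0" if "x \<in> V" for x
  proof (cases "x = 0")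
    case False
    let ?y = "(1 / norm x) *\<^sub>R x"
    have "?y \<in> ?K" using that V False by (simp add: subspace_scale)
    then have "c \<le> ?y \<bullet> (M *v ?y)" unfolding c_def by (rule vmin)
    also have "\<dots> = x \<bullet> (M *v x) / (x \<bullet> x)"
      by (simp only: matrix_vector_mult_scaleR inner_scaleR_left inner_scaleR_right)
        (simp add: dot_square_norm power2_eq_square)
    finally have "c * (x \<bullet> x) \<le> x \<bullet> (M *v x)" using False by (simp add: pos_le_divide_eq)
    then show ?thesis by (simp add: Nv inner_diff_right)
  qed simp
  moreover have "v \<bullet> (N *v v) = 0"
    using v by (simp add: Nv inner_diff_right c_def flip: power2_norm_eq_inner)
  ultimately have "N *v v = 0" using nonneg_form_zero_imp_kernel[of N V v] V v by blast
  then show ?thesis using that[of v c] v by (simp add: Nv)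
qed

definition orthonormal :: "'a::real_inner set \<Rightarrow> bool" where
  "orthonormal S \<longleftrightarrow> pairwise orthogonal S \<and> (\<forall>b\<in>S. norm b = 1)"

lemma orthonormal_finite:
  fixes S :: "'a::euclidean_space set"
  assumes "orthonormal S" shows "finite S" "independent S"
proof -
  have "0 \<notin> S" using assms by (auto simp: orthonormal_def)
  then show "independent S" using assms pairwise_orthogonal_independent by (auto simp: orthonormal_def)
  then show "finite S" using independent_bound by blast
qed

text \<open>Eigenvectors are collected one at a time: the orthogonal complement of those already found is
  invariant because the matrix is symmetric, so it contains another one.\<close>
theorem spectral_theorem:
  fixes M :: "real^'n^'n"
  assumes sym: "transpose M = M"
  obtains S c where "orthonormal S" "span S = UNIV" "\<And>b. b \<in> S \<Longrightarrow> M *v b = c b *\<^sub>R b"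
proof -
  have "\<exists>S. orthonormal S \<and> card S = k \<and> (\<forall>b\<in>S. \<exists>c. M *v b = c *\<^sub>R b)" if "k \<le> CARD('n)" for k
    using that
  proof (induction k)
    case 0
    show ?case by (rule exI[of _ "{}"]) (simp add: orthonormal_def)
  next
    case (Suc k)
    then obtain S where S: "orthonormal S" "card S = k" "\<forall>b\<in>S. \<exists>c. M *v b = c *\<^sub>R b" by auto
    define V where "V = {x. \<forall>b\<in>S. orthogonal b x}"
    have V: "subspace V"
      by (auto simp: V_def subspace_def orthogonal_clauses)
    have inv: "M *v x \<in> V" if "x \<in> V" for x
    proof -
      have "b \<bullet> (M *v x) = 0" if "b \<in> S" for b
      proof -
        obtain c where c: "M *v b = c *\<^sub>R b" using S(3) \<open>b \<in> S\<close> by fast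
        have "b \<bullet> x = 0" using \<open>x \<in> V\<close> \<open>b \<in> S\<close> by (simp add: V_def orthogonal_def)
        then show ?thesis using inner_mult_sym[OF sym, of b x] by (simp only: c inner_scaleR_left mult_zero_right)
      qed
      then show ?thesis by (simp add: V_def orthogonal_def)
    qed
    have "dim S < DIM(real^'n)"
      using orthonormal_finite[OF S(1)] S(2) Suc.prems by (simp add: dim_eq_card_independent)
    then have "span S \<noteq> UNIV" using dim_eq_full[of S] by auto
    then have "span S \<subset> span UNIV" by auto
    from orthogonal_to_subspace_exists_gen[OF this]
    obtain a where a: "a \<noteq> 0" "\<And>x. x \<in> span S \<Longrightarrow> orthogonal a x" by blast
    have "a \<in> V" using a(2)[OF span_base] by (simp add: V_def orthogonal_commute)
    then have "V \<noteq> {0}" using a by blast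
    then obtain v c where v: "v \<in> V" "norm v = 1" "M *v v = c *\<^sub>R v"
      using eigenvector_in_invariant_subspace[OF sym V _ inv] by blast
    have "v \<notin> S"
    proof
      assume "v \<in> S"
      then have "orthogonal v v" using v by (simp add: V_def)
      then show False using v by (simp add: orthogonal_self)
    qed
    moreover have "orthonormal (insert v S)"
      using S v by (auto simp: orthonormal_def pairwise_insert V_def orthogonal_commute)
    moreover have "card (insert v S) = Suc k"
      using \<open>v \<notin> S\<close> S(2) orthonormal_finite(1)[OF S(1)] by simp
    ultimately show ?case using S v by (intro exI[of _ "insert v S"]) auto
  qed
  from this[of "CARD('n)"] obtain S where S: "orthonormal S" "card S = CARD('n)"
    "\<forall>b\<in>S. \<exists>c. M *v b = c *\<^sub>R b" by auto
  have "span S = UNIV"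
    using card_ge_dim_independent[of S UNIV] orthonormal_finite[OF S(1)] S(2) by auto
  moreover obtain c where "\<And>b. b \<in> S \<Longrightarrow> M *v b = c b *\<^sub>R b" using S(3) by metis
  ultimately show ?thesis using that S by blast
qed

lemma orthonormal_expansion:
  fixes S :: "'a::euclidean_space set"
  assumes "orthonormal S" "span S = UNIV"
  shows "(\<Sum>b\<in>S. (b \<bullet> x) *\<^sub>R b) = x" "x \<bullet> y = (\<Sum>b\<in>S. (b \<bullet> x) * (b \<bullet> y))"
proof -
  have fin: "finite S" using assms orthonormal_finite by blast
  define z where "z = x - (\<Sum>b\<in>S. (b \<bullet> x) *\<^sub>R b)"
  have ip: "b \<bullet> (\<Sum>b'\<in>S. f b' *\<^sub>R b') = f b" if "b \<in> S" for b f
  proof -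
    have "b \<bullet> (\<Sum>b'\<in>S. f b' *\<^sub>R b') = (\<Sum>b'\<in>S. if b' = b then f b else 0)"
      unfolding inner_sum_right
      using assms(1) that by (intro sum.cong) (auto simp: orthonormal_def pairwise_def orthogonal_def norm_eq_1)
    then show ?thesis using fin that by simp
  qed
  have "orthogonal z b" if "b \<in> S" for b
    using ip[OF that, of "\<lambda>b. b \<bullet> x"] by (simp add: z_def orthogonal_def inner_diff_left inner_diff_right inner_commute)
  then have "orthogonal z z" using orthogonal_to_span[of z S z] assms(2) by simp
  then show 1: "(\<Sum>b\<in>S. (b \<bullet> x) *\<^sub>R b) = x" by (simp add: z_def orthogonal_self)
  have "x \<bullet> y = (\<Sum>b\<in>S. (b \<bullet> x) *\<^sub>R b) \<bullet> y" by (simp add: 1)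
  then show "x \<bullet> y = (\<Sum>b\<in>S. (b \<bullet> x) * (b \<bullet> y))" by (simp add: inner_sum_left)
qed

text \<open>In an orthonormal eigenbasis the matrix is diagonal, hence every eigenvalue occurs as a diagonal
  entry and the quadratic form is a weighted sum of squares.\<close>
lemma eigvals_of_eigenbasis:
  fixes M :: "real^'n^'n"
  assumes sym: "transpose M = M" and S: "orthonormal S" "span S = UNIV"
    and c: "\<And>b. b \<in> S \<Longrightarrow> M *v b = c b *\<^sub>R b"
  shows "eigvals M = c ` S" "S \<noteq> {}" "x \<bullet> (M *v x) = (\<Sum>b\<in>S. c b * (b \<bullet> x)\<^sup>2)"
proof -
  have coord: "b \<bullet> (M *v v) = c b * (b \<bullet> v)" if "b \<in> S" for b v
    using inner_mult_sym[OF sym, of b v] c[OF that] by simp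
  show "eigvals M = c ` S"
  proof
    show "c ` S \<subseteq> eigvals M"
    proof
      fix e assume "e \<in> c ` S"
      then obtain b where b: "b \<in> S" "e = c b" by blast
      then have "b \<noteq> 0" using S(1) by (auto simp: orthonormal_def)
      then show "e \<in> eigvals M" using c[OF b(1)] b(2)
        unfolding eigvals_def scalar_mult_eq_scaleR by blast
    qed
    show "eigvals M \<subseteq> c ` S"
    proof
      fix e assume "e \<in> eigvals M"
      then obtain v where v: "v \<noteq> 0" "M *v v = e *\<^sub>R v" by (auto simp: eigvals_def scalar_mult_eq_scaleR)
      have "\<exists>b\<in>S. b \<bullet> v \<noteq> 0"
      proof (rule ccontr)
        assume "\<not> ?thesis"
        then have "v \<bullet> v = 0" using orthonormal_expansion(2)[OF S, of v v] by simp
        then show False using v by simp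
      qed
      then obtain b where "b \<in> S" "b \<bullet> v \<noteq> 0" by blast
      then show "e \<in> c ` S" using coord[of b v] v by auto
    qed
  qed
  show "S \<noteq> {}"
  proof
    assume "S = {}"
    then have "(1::real^'n) = 0" using S by auto
    then show False by simp
  qed
  show "x \<bullet> (M *v x) = (\<Sum>b\<in>S. c b * (b \<bullet> x)\<^sup>2)"
    using orthonormal_expansion(2)[OF S, of x "M *v x"] by (simp add: coord power2_eq_square mult_ac)
qed

lemma eigvals_symmetric_finite:
  fixes M :: "real^'n^'n"
  assumes "transpose M = M"
  shows "finite (eigvals M)" "eigvals M \<noteq> {}"
proof -
  obtain S c where S: "orthonormal S" "span S = UNIV" "\<And>b. b \<in> S \<Longrightarrow> M *v b = c b *\<^sub>R b"
    using spectral_theorem[OF assms] by blast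
  then show "finite (eigvals M)" "eigvals M \<noteq> {}"
    using eigvals_of_eigenbasis[OF assms S] orthonormal_finite[of S] by auto
qed

lemma rayleigh_bounds:
  fixes M :: "real^'n^'n"
  assumes sym: "transpose M = M"
  shows "lam_min M * (x \<bullet> x) \<le> x \<bullet> (M *v x)" "x \<bullet> (M *v x) \<le> lam_max M * (x \<bullet> x)"
proof -
  obtain S c where S: "orthonormal S" "span S = UNIV" "\<And>b. b \<in> S \<Longrightarrow> M *v b = c b *\<^sub>R b"
    using spectral_theorem[OF sym] by blast
  note E = eigvals_of_eigenbasis[OF sym S]
  have fin: "finite S" using S orthonormal_finite by blast
  have "lam_min M \<le> c b" "c b \<le> lam_max M" if "b \<in> S" for b
    using that fin by (auto simp: lam_min_def lam_max_def E(1))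
  then have "(\<Sum>b\<in>S. lam_min M * (b \<bullet> x)\<^sup>2) \<le> (\<Sum>b\<in>S. c b * (b \<bullet> x)\<^sup>2)"
       "(\<Sum>b\<in>S. c b * (b \<bullet> x)\<^sup>2) \<le> (\<Sum>b\<in>S. lam_max M * (b \<bullet> x)\<^sup>2)"
    by (auto intro!: sum_mono mult_right_mono)
  then show "lam_min M * (x \<bullet> x) \<le> x \<bullet> (M *v x)" "x \<bullet> (M *v x) \<le> lam_max M * (x \<bullet> x)"
    using orthonormal_expansion(2)[OF S(1,2), of x x]
    by (simp_all add: E(3) sum_distrib_left power2_eq_square)
qed

lemma lam_min_attained:
  fixes M :: "real^'n^'n"
  assumes sym: "transpose M = M"
  shows "\<exists>v. v \<noteq> 0 \<and> M *v v = lam_min M *\<^sub>R v"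
  using Min_in[OF eigvals_symmetric_finite[OF sym]]
  by (auto simp: lam_min_def eigvals_def scalar_mult_eq_scaleR)

lemma pos_def_lam:
  fixes M :: "real^'n^'n"
  assumes "pos_def M"
  shows "0 < lam_min M" "lam_min M \<le> lam_max M"
proof -
  have sym: "transpose M = M" using assms by (simp add: pos_def_def)
  obtain v where v: "v \<noteq> 0" "M *v v = lam_min M *\<^sub>R v" using lam_min_attained[OF sym] by blast
  have "0 < lam_min M * (v \<bullet> v)" using assms v by (force simp: pos_def_def)
  then show "0 < lam_min M" by (metis inner_ge_zero not_less zero_less_mult_iff)
  have "lam_min M * (v \<bullet> v) \<le> lam_max M * (v \<bullet> v)"
    using rayleigh_bounds[OF sym, of v] by linarith
  then show "lam_min M \<le> lam_max M" using v by simp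
qed

text \<open>On an eigenvector \<open>b\<close> of \<open>S\<close> with eigenvalue \<open>c\<close>, the vector \<open>w = T b - c b\<close> satisfies
  \<open>T w = - c w\<close> because \<open>S\<^sup>2 = T\<^sup>2\<close>. As \<open>T\<close> is positive semidefinite and \<open>c \<ge> 0\<close>, this forces
  \<open>c = 0\<close> or \<open>w = 0\<close>.\<close>
lemma psd_sqrt_unique:
  fixes S T :: "real^'n^'n"
  assumes S: "pos_semidef S" and T: "pos_semidef T" and eq: "S ** S = T ** T"
  shows "S = T"
proof -
  have symS: "transpose S = S" and symT: "transpose T = T" using S T by (auto simp: pos_semidef_def)
  obtain E c where E: "orthonormal E" "span E = UNIV" "\<And>b. b \<in> E \<Longrightarrow> S *v b = c b *\<^sub>R b"
    using spectral_theorem[OF symS] by blast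
  have "T *v b = S *v b" if b: "b \<in> E" for b
  proof -
    have nb: "b \<bullet> b = 1" using E(1) b by (simp add: orthonormal_def norm_eq_1)
    have c: "c b \<ge> 0"
      using S E(3)[OF b] nb by (metis inner_scaleR_right mult.right_neutral pos_semidef_def)
    define w where "w = T *v b - c b *\<^sub>R b"
    have "T *v (T *v b) = c b *\<^sub>R c b *\<^sub>R b"
      using eq E(3)[OF b] by (metis matrix_vector_mul_assoc matrix_vector_mult_scaleR)
    then have Tw: "T *v w = - (c b *\<^sub>R w)"
      by (simp add: w_def matrix_vector_mult_diff_distrib matrix_vector_mult_scaleR scaleR_diff_right)
    have "w \<bullet> (T *v w) \<ge> 0" using T by (simp add: pos_semidef_def)
    then have "c b * (w \<bullet> w) \<le> 0" by (simp add: Tw)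
    then have "c b = 0 \<or> w = 0" using c
      by (metis antisym inner_ge_zero inner_eq_zero_iff mult_eq_0_iff mult_nonneg_nonneg)
    moreover have "w = 0" if "c b = 0"
    proof -
      have "w \<bullet> w = (T *v b) \<bullet> (T *v b)" using that by (simp add: w_def)
      also have "\<dots> = b \<bullet> (T *v w)" using that inner_mult_sym[OF symT] by (simp add: w_def)
      also have "\<dots> = 0" using that by (simp add: Tw)
      finally show ?thesis by simp
    qed
    ultimately show ?thesis using E(3)[OF b] by (auto simp: w_def)
  qed
  then have "T *v x = S *v x" for x
    using linear_eq_on[of "(*v) T" "(*v) S" x E] E(2) by auto
  then show ?thesis by (simp add: matrix_eq)
qed

lemma matrix_inv_cancel:
  fixes M :: "real^'n^'n"
  assumes "\<And>x. M *v x = 0 \<Longrightarrow> x = 0"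
  shows "matrix_inv M ** M = mat 1" "M ** matrix_inv M = mat 1"
proof -
  have "inj ((*v) M)" using assms by (simp add: linear_injective_0)
  then have "invertible M" by (simp add: invertible_left_inverse matrix_left_invertible_injective)
  then have "\<exists>M'. M ** M' = mat 1 \<and> M' ** M = mat 1" by (simp add: invertible_def)
  then have "M ** matrix_inv M = mat 1 \<and> matrix_inv M ** M = mat 1"
    unfolding matrix_inv_def by (rule someI_ex)
  then show "matrix_inv M ** M = mat 1" "M ** matrix_inv M = mat 1" by auto
qed

lemma pos_def_inv_cancel:
  fixes M :: "real^'n^'n"
  assumes "pos_def M"
  shows "matrix_inv M *v (M *v x) = x" "M *v (matrix_inv M *v x) = x"
proof -
  have "x = 0" if "M *v x = 0" for x
    using assms that unfolding pos_def_def by (metis inner_zero_right less_irrefl)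
  from matrix_inv_cancel[OF this]
  show "matrix_inv M *v (M *v x) = x" "M *v (matrix_inv M *v x) = x"
    by (simp_all add: matrix_vector_mul_assoc)
qed

text \<open>The definition of the square root by unique description is meaningful by the spectral theorem
  (existence) and the previous lemma (uniqueness). The third property turns weighted norms into
  Euclidean norms, so that the triangle inequality is available for them.\<close>
lemma mat_sqrt:
  fixes M :: "real^'n^'n"
  assumes M: "pos_def M"
  shows "transpose (mat_sqrt M) = mat_sqrt M" "mat_sqrt M ** mat_sqrt M = M"
    "(norm (mat_sqrt M *v x))\<^sup>2 = x \<bullet> (M *v x)"
    "inv_sqrt M *v (mat_sqrt M *v x) = x" "mat_sqrt M *v (inv_sqrt M *v x) = x"
    "transpose (inv_sqrt M) = inv_sqrt M"
proof -
  have sym: "transpose M = M" using M by (simp add: pos_def_def)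
  obtain E c where E: "orthonormal E" "span E = UNIV" "\<And>b. b \<in> E \<Longrightarrow> M *v b = c b *\<^sub>R b"
    using spectral_theorem[OF sym] by blast
  have cpos: "c b \<ge> 0" if b: "b \<in> E" for b
  proof -
    have "b \<bullet> b = 1" "b \<noteq> 0" using E(1) b by (auto simp: orthonormal_def norm_eq_1)
    then have "b \<bullet> (M *v b) > 0" using M by (auto simp: pos_def_def)
    then show ?thesis using E(3)[OF b] \<open>b \<bullet> b = 1\<close> by simp
  qed
  define f where "f = (\<lambda>x. \<Sum>b\<in>E. (sqrt (c b) * (b \<bullet> x)) *\<^sub>R b)"
  have lin: "linear f"
    by (rule linearI) (simp_all add: f_def inner_add_right algebra_simps sum.distrib scaleR_sum_right)
  define T where "T = matrix f"
  have Tv: "T *v x = f x" for x by (simp add: T_def matrix_works lin)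
  have ip: "y \<bullet> (T *v x) = (\<Sum>b\<in>E. sqrt (c b) * (b \<bullet> x) * (b \<bullet> y))" for x y
    by (simp add: Tv f_def inner_sum_right inner_commute)
  have symT: "transpose T = T"
    by (rule symmetricI) (subst inner_commute, simp add: ip mult_ac)
  have psd: "pos_semidef T"
    unfolding pos_semidef_def using symT cpos by (auto simp: ip intro!: sum_nonneg simp: mult.assoc)
  have Tb: "T *v b = sqrt (c b) *\<^sub>R b" if b: "b \<in> E" for b
  proof -
    have "finite E" using E orthonormal_finite by blast
    have "T *v b = (\<Sum>b'\<in>E. if b' = b then sqrt (c b) *\<^sub>R b else 0)"
      unfolding Tv f_def
      using E(1) b by (intro sum.cong) (auto simp: orthonormal_def pairwise_def orthogonal_def norm_eq_1)
    then show ?thesis using \<open>finite E\<close> b by simp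
  qed
  have "(T ** T) *v b = M *v b" if b: "b \<in> E" for b
    using E(3)[OF b] cpos[OF b] by (simp add: Tb[OF b] matrix_vector_mult_scaleR flip: matrix_vector_mul_assoc)
  then have "(T ** T) *v x = M *v x" for x
    using linear_eq_on[of "(*v) (T ** T)" "(*v) M" x E] E(2) by auto
  then have sq: "T ** T = M" by (simp add: matrix_eq)
  have TM: "mat_sqrt M = T"
    unfolding mat_sqrt_def using psd sq psd_sqrt_unique by (intro the_equality) auto
  show 1: "transpose (mat_sqrt M) = mat_sqrt M" "mat_sqrt M ** mat_sqrt M = M"
    using TM symT sq by auto
  show n: "(norm (mat_sqrt M *v x))\<^sup>2 = x \<bullet> (M *v x)" for x
    using 1 by (metis inner_mult_sym matrix_vector_mul_assoc power2_norm_eq_inner)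
  have "x = 0" if "mat_sqrt M *v x = 0" for x
    using n[of x] that M unfolding pos_def_def
    by (metis less_irrefl norm_zero zero_power2)
  from matrix_inv_cancel[OF this]
  show i1: "inv_sqrt M *v (mat_sqrt M *v x) = x" and i2: "mat_sqrt M *v (inv_sqrt M *v x) = x" for x
    by (simp_all add: matrix_vector_mul_assoc)
  show "transpose (inv_sqrt M) = inv_sqrt M"
  proof (rule symmetricI)
    fix x y
    have "(inv_sqrt M *v x) \<bullet> y = (inv_sqrt M *v x) \<bullet> (mat_sqrt M *v (inv_sqrt M *v y))"
      by (simp add: i2)
    also have "\<dots> = (mat_sqrt M *v (inv_sqrt M *v x)) \<bullet> (inv_sqrt M *v y)"
      by (rule inner_mult_sym[OF 1(1), symmetric])
    also have "\<dots> = x \<bullet> (inv_sqrt M *v y)" by (simp only: i2)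
    finally show "(inv_sqrt M *v x) \<bullet> y = x \<bullet> (inv_sqrt M *v y)" .
  qed
qed

text \<open>The substitution \<open>y = W\<^sup>1\<^sup>/\<^sup>2 x\<close> turns the weighted eigenvalue into an ordinary one. The upper bound 1
  follows by comparing both forms at an eigenvector for the smallest eigenvalue.\<close>
lemma lam_min_wrt_bound:
  fixes W Q :: "real^'n^'n"
  assumes W: "pos_def W" and Q: "pos_def Q" and le: "\<And>x. x \<bullet> (Q *v x) \<le> x \<bullet> (W *v x)"
  shows "lam_min_wrt W Q * (x \<bullet> (W *v x)) \<le> x \<bullet> (Q *v x)" "0 < lam_min_wrt W Q" "lam_min_wrt W Q \<le> 1"
proof -
  let ?N = "inv_sqrt W ** Q ** inv_sqrt W"
  note S = mat_sqrt[OF W]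
  have symQ: "transpose Q = Q" using Q by (simp add: pos_def_def)
  have form: "y \<bullet> (?N *v y) = (inv_sqrt W *v y) \<bullet> (Q *v (inv_sqrt W *v y))" for y
    using inner_mult_sym[OF S(6)] by (simp flip: matrix_vector_mul_assoc)
  have sym: "transpose ?N = ?N"
    by (simp add: matrix_transpose_mul S(6) symQ matrix_mul_assoc)
  show "lam_min_wrt W Q * (x \<bullet> (W *v x)) \<le> x \<bullet> (Q *v x)"
    using rayleigh_bounds(1)[OF sym, of "mat_sqrt W *v x"] S(3)[of x]
    by (simp add: form S(4) lam_min_wrt_def power2_norm_eq_inner)
  have "pos_def ?N"
    unfolding pos_def_def
  proof (intro conjI allI impI)
    fix y :: "real^'n" assume "y \<noteq> 0"
    then have "inv_sqrt W *v y \<noteq> 0" using S(5)[of y] by (metis matrix_vector_mult_0_right)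
    then show "0 < y \<bullet> (?N *v y)" using Q by (simp add: form pos_def_def)
  qed (rule sym)
  then show "0 < lam_min_wrt W Q" using pos_def_lam by (simp add: lam_min_wrt_def)
  obtain v where v: "v \<noteq> 0" "?N *v v = lam_min_wrt W Q *\<^sub>R v"
    using lam_min_attained[OF sym] by (auto simp: lam_min_wrt_def)
  let ?x = "inv_sqrt W *v v"
  have "lam_min_wrt W Q * (v \<bullet> v) = ?x \<bullet> (Q *v ?x)" using form[of v] v by simp
  also have "\<dots> \<le> ?x \<bullet> (W *v ?x)" by (rule le)
  also have "\<dots> = v \<bullet> v" using S(3)[of ?x] by (simp add: S(5) power2_norm_eq_inner)
  finally show "lam_min_wrt W Q \<le> 1" using v by simp
qed

lemma mat_norm_bound:
  fixes A :: "real^'n^'m"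
  shows "norm (A *v x) \<le> mat_norm A * norm x" "0 \<le> mat_norm A"
proof -
  have "bounded_linear ((*v) A)" by (simp add: linear_conv_bounded_linear[symmetric])
  then show "norm (A *v x) \<le> mat_norm A * norm x" "0 \<le> mat_norm A"
    using onorm onorm_pos_le unfolding mat_norm_def by blast+
qed

section \<open>Linear rate of the accelerated projected gradient method\<close>

text \<open>The basic inequality of projected gradient methods. The variational inequality of the projection
  replaces the gradient term, and the three-point identity for squared distances finishes the proof.
  The last term is zero if \<open>\<mu> = L\<close>, so that one step is then exact.\<close>
lemma projected_gradient_step:
  fixes D :: "'a::euclidean_space"
  assumes Z: "convex Z" "closed Z" and w: "w \<in> Z" and L: "0 < L"
    and z': "z' = closest_point Z (y - inverse L *\<^sub>R D)"
    and upper: "g z' \<le> g y + D \<bullet> (z' - y) + L / 2 * (norm (z' - y))\<^sup>2"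
    and lower: "g y + D \<bullet> (w - y) + \<mu> / 2 * (norm (w - y))\<^sup>2 \<le> g w"
  shows "g z' + L / 2 * (norm (z' - w))\<^sup>2 \<le> g w + (L - \<mu>) / 2 * (norm (w - y))\<^sup>2"
proof -
  have "(y - inverse L *\<^sub>R D - z') \<bullet> (w - z') \<le> 0"
    unfolding z' by (rule closest_point_dot[OF Z w])
  then have "L * ((y - z') \<bullet> (w - z')) \<le> L * (inverse L * (D \<bullet> (w - z')))"
    using L by (intro mult_left_mono) (simp_all add: inner_diff_left)
  then have vi: "L * ((y - z') \<bullet> (w - z')) \<le> D \<bullet> (w - z')"
    using L by (simp add: mult.assoc[symmetric] del: mult_le_cancel_left_pos)
  have "D \<bullet> (z' - y) = D \<bullet> (w - y) - D \<bullet> (w - z')" by (simp add: inner_diff_right)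
  moreover have "L * ((y - z') \<bullet> (w - z'))
      = L / 2 * (norm (z' - y))\<^sup>2 + L / 2 * (norm (z' - w))\<^sup>2 - L / 2 * (norm (w - y))\<^sup>2"
    by (simp add: power2_norm_eq_inner inner_diff_left inner_diff_right inner_commute algebra_simps)
  ultimately show ?thesis using upper lower vi
    by (simp add: diff_divide_distrib left_diff_distrib)
qed

text \<open>The lower bound with the linearization at \<open>w\<close> is used at both end points; in the convex
  combination the linear terms cancel.\<close>
lemma strongly_convex_segment:
  fixes D :: "'a::real_inner"
  assumes t: "0 \<le> t" "t \<le> 1" and w: "w = (1 - t) *\<^sub>R z + t *\<^sub>R u"
    and lower: "\<And>v. g w + D \<bullet> (v - w) + \<mu> / 2 * (norm (v - w))\<^sup>2 \<le> g v"
  shows "g w \<le> (1 - t) * g z + t * g u - \<mu> / 2 * (t * (1 - t)) * (norm (z - u))\<^sup>2"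
proof -
  have zw: "z - w = t *\<^sub>R (z - u)" and uw: "u - w = (t - 1) *\<^sub>R (z - u)"
    by (simp_all add: w algebra_simps)
  define d where "d = D \<bullet> (z - u)"
  define n where "n = (norm (z - u))\<^sup>2"
  have "g w + t * d + \<mu> / 2 * (t\<^sup>2 * n) \<le> g z"
    using lower[of z] unfolding zw by (simp add: d_def n_def power_mult_distrib)
  then have 1: "(1 - t) * (g w + t * d + \<mu> / 2 * (t\<^sup>2 * n)) \<le> (1 - t) * g z"
    using t by (intro mult_left_mono) auto
  have "g w + (t - 1) * d + \<mu> / 2 * ((t - 1)\<^sup>2 * n) \<le> g u"
    using lower[of u] unfolding uw by (simp add: d_def n_def power_mult_distrib)
  then have 2: "t * (g w + (t - 1) * d + \<mu> / 2 * ((t - 1)\<^sup>2 * n)) \<le> t * g u"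
    using t by (intro mult_left_mono) auto
  have "(1 - t) * (g w + t * d + \<mu> / 2 * (t\<^sup>2 * n))
      + t * (g w + (t - 1) * d + \<mu> / 2 * ((t - 1)\<^sup>2 * n)) = g w + \<mu> / 2 * (t * (1 - t)) * n"
    by (simp add: power2_eq_square field_simps)
  then show ?thesis using 1 2 unfolding n_def by linarith
qed

text \<open>The formula for \<open>t\<close> is the positive root of \<open>t\<^sup>2 + \<zeta> t = \<theta>\<^sup>2\<close>, whose left-hand side increases on the
  positive axis; the bounds on \<open>t\<close> follow by comparing its values.\<close>
lemma apg_theta_step:
  fixes \<theta> q :: real
  assumes q: "0 < q" "q < 1" and \<theta>: "sqrt q < \<theta>" "\<theta> \<le> 1"
  defines "\<zeta> \<equiv> \<theta>\<^sup>2 - q"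
  defines "t \<equiv> \<zeta> / 2 * (sqrt (1 + 4 * \<theta>\<^sup>2 / \<zeta>\<^sup>2) - 1)"
  shows "t\<^sup>2 = (1 - t) * \<theta>\<^sup>2 + q * t" "sqrt q < t" "t \<le> 1"
proof -
  have sq: "0 < sqrt q" "sqrt q < 1" "(sqrt q)\<^sup>2 = q" using q by auto
  have "(sqrt q)\<^sup>2 < \<theta>\<^sup>2" using \<theta> sq by (intro power_strict_mono) auto
  then have \<zeta>: "\<zeta> > 0" using sq by (simp add: \<zeta>_def)
  have \<theta>0: "\<theta> > 0" using \<theta> sq by linarith
  define r where "r = sqrt (1 + 4 * \<theta>\<^sup>2 / \<zeta>\<^sup>2)"
  have r: "r\<^sup>2 = 1 + 4 * \<theta>\<^sup>2 / \<zeta>\<^sup>2" by (simp add: r_def)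
  have t: "t = \<zeta> / 2 * (r - 1)" by (simp add: t_def r_def)
  have root: "t\<^sup>2 + \<zeta> * t = \<theta>\<^sup>2"
  proof -
    have "\<zeta>\<^sup>2 * r\<^sup>2 = \<zeta>\<^sup>2 + 4 * \<theta>\<^sup>2"
      using \<zeta> r by (simp add: field_simps)
    moreover have "4 * (t\<^sup>2 + \<zeta> * t) = \<zeta>\<^sup>2 * r\<^sup>2 - \<zeta>\<^sup>2"
      by (simp add: t power2_eq_square field_simps)
    ultimately show ?thesis by simp
  qed
  then show "t\<^sup>2 = (1 - t) * \<theta>\<^sup>2 + q * t" by (simp add: \<zeta>_def algebra_simps)
  have "1 < r" using \<zeta> \<theta>0 by (simp add: r_def)
  then have t0: "t > 0" unfolding t using \<zeta> by simp
  have mono: "a < t" if "a\<^sup>2 + \<zeta> * a < t\<^sup>2 + \<zeta> * t" for a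
  proof (rule ccontr)
    assume "\<not> a < t"
    then have "t\<^sup>2 \<le> a\<^sup>2" "\<zeta> * t \<le> \<zeta> * a" 
      using t0 \<zeta> by (simp_all add: power_mono)
    then show False using that by linarith
  qed
  show "sqrt q < t"
  proof (rule mono)
    have "\<zeta> * sqrt q < \<zeta> * 1" using \<zeta> sq by (intro mult_strict_left_mono) auto
    then show "(sqrt q)\<^sup>2 + \<zeta> * sqrt q < t\<^sup>2 + \<zeta> * t"
      unfolding root using sq by (simp add: \<zeta>_def)
  qed
  have "t\<^sup>2 < \<theta>\<^sup>2" using root mult_pos_pos[OF \<zeta> t0] by linarith
  then have "t < \<theta>" using \<theta>0 by (simp add: power2_less_imp_less)
  then show "t \<le> 1" using \<theta> by simp
qed

lemma apg_theta_bounds: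
  assumes "1 < \<kappa>"
  shows "sqrt (inverse \<kappa>) < apg_theta \<kappa> k" "apg_theta \<kappa> k \<le> 1"
proof -
  have q: "0 < inverse \<kappa>" "inverse \<kappa> < 1" using assms by (auto simp: field_simps)
  have "sqrt (inverse \<kappa>) < apg_theta \<kappa> k \<and> apg_theta \<kappa> k \<le> 1"
  proof (induction k)
    case 0
    then show ?case using q by simp
  next
    case (Suc k)
    then show ?case using apg_theta_step(2,3)[OF q, of "apg_theta \<kappa> k"] by (simp add: Let_def)
  qed
  then show "sqrt (inverse \<kappa>) < apg_theta \<kappa> k" "apg_theta \<kappa> k \<le> 1" by auto
qed

lemma apg_theta_rec:
  assumes "1 < \<kappa>"
  shows "(apg_theta \<kappa> (Suc k))\<^sup>2
    = (1 - apg_theta \<kappa> (Suc k)) * (apg_theta \<kappa> k)\<^sup>2 + inverse \<kappa> * apg_theta \<kappa> (Suc k)"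
proof -
  have q: "0 < inverse \<kappa>" "inverse \<kappa> < 1" using assms by (auto simp: field_simps)
  show ?thesis
    using apg_theta_step(1)[OF q apg_theta_bounds[OF assms, of k]] by (simp add: Let_def)
qed

text \<open>The first accelerated step contracts by \<open>1 - \<theta>\<^sub>1\<close>, which is less than \<open>1 - s\<close>. As
  \<open>\<theta>\<^sub>1\<close> is the positive root of \<open>t\<^sup>2 + (1 - s\<^sup>2) t = 1\<close>, the claim is that this quadratic is
  at most 1 at the point \<open>a\<close> where equality would hold. This is where the factor \<open>\<surd>2\<close> comes from that
  the coupling with the plant needs.\<close>
lemma apg_theta_1:
  assumes \<kappa>: "1 < \<kappa>"
  defines "s \<equiv> sqrt (inverse \<kappa>)"
  shows "(1 + s) * (1 - apg_theta \<kappa> 1) \<le> 1 / 2"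
proof -
  have s: "0 < s" "s < 1" and s2: "s\<^sup>2 = inverse \<kappa>" using \<kappa> by (auto simp: s_def field_simps)
  define t where "t = apg_theta \<kappa> 1"
  have t: "t\<^sup>2 + (1 - s\<^sup>2) * t = 1"
    using apg_theta_rec[OF \<kappa>, of 0] by (simp add: t_def s2 algebra_simps)
  have t0: "0 < t" using apg_theta_bounds(1)[OF \<kappa>, of 1] s(1) unfolding t_def s_def by linarith
  have q: "1 - s\<^sup>2 \<ge> 0" using s by (simp add: abs_square_le_1)
  define a where "a = (1 + 2 * s) / (2 * (1 + s))"
  have "a * (2 * (1 + s)) = 1 + 2 * s" using s by (simp add: a_def)
  have "a \<le> t"
  proof (rule ccontr)
    assume "\<not> a \<le> t"
    then have "t\<^sup>2 < a\<^sup>2" using t0 by (intro power_strict_mono) auto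
    moreover have "(1 - s\<^sup>2) * t \<le> (1 - s\<^sup>2) * a" using q \<open>\<not> a \<le> t\<close> by (intro mult_left_mono) auto
    ultimately have "1 < a\<^sup>2 + (1 - s\<^sup>2) * a" using t by linarith
    then have "0 < (2 * (1 + s))\<^sup>2 * (a\<^sup>2 + (1 - s\<^sup>2) * a - 1)" using s by simp
    also have "\<dots> = (a * (2 * (1 + s)))\<^sup>2 + (1 - s\<^sup>2) * (a * (2 * (1 + s))) * (2 * (1 + s))
        - (2 * (1 + s))\<^sup>2"
      by (simp add: power2_eq_square algebra_simps)
    also have "\<dots> = - (1 - 2 * s - 2 * s\<^sup>2 + 6 * s ^ 3 + 4 * s ^ 4)"
      unfolding \<open>a * (2 * (1 + s)) = 1 + 2 * s\<close>
      by (simp add: power2_eq_square power3_eq_cube power4_eq_xxxx algebra_simps)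
    \<comment> \<open>a certificate of positivity for \<open>s > 0\<close>\<close>
    also have "1 - 2 * s - 2 * s\<^sup>2 + 6 * s ^ 3 + 4 * s ^ 4
        = (1 - s - 3/2 * s\<^sup>2)\<^sup>2 + 3 * s ^ 3 + 7/4 * s ^ 4"
      by (simp add: power2_eq_square power3_eq_cube power4_eq_xxxx algebra_simps)
    finally show False 
      using zero_le_power2[of "1 - s - 3/2 * s\<^sup>2"] zero_less_power[OF s(1), of 3]
        zero_less_power[OF s(1), of 4] by linarith
  qed
  then have "(1 + s) * (1 - t) \<le> (1 + s) * (1 - a)" using s by simp
  also have "\<dots> = 1 / 2" using s by (simp add: a_def field_simps)
  finally show ?thesis by (simp add: t_def)
qed

text \<open>The extrapolated point differs from the comparison point by a multiple of
  \<open>\<gamma> p + \<mu> \<theta> r\<close>, where \<open>p\<close> and \<open>r\<close> are the distances of the two sequences from the minimizer. The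
  recursion for \<open>\<theta>\<close> is exactly what makes convexity of the squared norm give this bound.\<close>
lemma apg_extrapolation_bound:
  fixes p r :: "'a::real_inner"
  assumes \<gamma>: "0 \<le> \<gamma>" and \<mu>: "0 < \<mu>" and \<theta>: "0 < \<theta>"
    and rec: "\<theta>\<^sup>2 * L = (1 - \<theta>) * \<gamma> + \<mu> * \<theta>" and \<theta>1: "\<theta> \<le> 1"
  shows "(L - \<mu>) * (norm ((\<theta> * \<gamma> / (\<gamma> + \<mu> * \<theta>)) *\<^sub>R p + (\<theta> - \<theta> * \<gamma> / (\<gamma> + \<mu> * \<theta>)) *\<^sub>R r))\<^sup>2
    \<le> (1 - \<theta>) * (\<gamma> * (norm p)\<^sup>2 + \<mu> * \<theta> * (norm r)\<^sup>2)"
proof -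
  define s where "s = \<gamma> + \<mu> * \<theta>"
  have s: "s > 0" using \<gamma> \<mu> \<theta> by (simp add: s_def add_nonneg_pos)
  have s\<theta>: "(L - \<mu>) * \<theta>\<^sup>2 = (1 - \<theta>) * s"
    using rec by (simp add: s_def power2_eq_square algebra_simps)
  define v where "v = \<gamma> *\<^sub>R p + (\<mu> * \<theta>) *\<^sub>R r"
  have "(\<theta> * \<gamma> / s) *\<^sub>R p + (\<theta> - \<theta> * \<gamma> / s) *\<^sub>R r = (\<theta> / s) *\<^sub>R v"
  proof -
    have "\<theta> - \<theta> * \<gamma> / s = \<theta> / s * (\<mu> * \<theta>)"
      using s by (simp add: s_def field_simps)
    then show ?thesis by (simp add: v_def scaleR_add_right)
  qed
  then have "(L - \<mu>) * (norm ((\<theta> * \<gamma> / s) *\<^sub>R p + (\<theta> - \<theta> * \<gamma> / s) *\<^sub>R r))\<^sup>2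
      = (L - \<mu>) * \<theta>\<^sup>2 / s\<^sup>2 * (norm v)\<^sup>2"
    by (simp add: power_mult_distrib power_divide)
  also have "\<dots> = (1 - \<theta>) / s * (norm v)\<^sup>2"
    unfolding s\<theta> using s by (simp add: power2_eq_square)
  also have "\<dots> \<le> (1 - \<theta>) / s * (s * (\<gamma> * (norm p)\<^sup>2 + \<mu> * \<theta> * (norm r)\<^sup>2))"
  proof (rule mult_left_mono)
    have "s * (\<gamma> * (norm p)\<^sup>2 + \<mu> * \<theta> * (norm r)\<^sup>2) - (norm v)\<^sup>2 = \<gamma> * (\<mu> * \<theta>) * (norm (p - r))\<^sup>2"
      by (simp add: s_def v_def power2_norm_eq_inner inner_add_left inner_add_right
          inner_diff_left inner_diff_right inner_commute algebra_simps)
    also have "\<dots> \<ge> 0" using \<gamma> \<mu> \<theta> by simp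
    finally show "(norm v)\<^sup>2 \<le> s * (\<gamma> * (norm p)\<^sup>2 + \<mu> * \<theta> * (norm r)\<^sup>2)" by simp
  qed (use \<theta>1 s in simp)
  finally show ?thesis using s by (simp add: s_def)
qed

text \<open>Nesterov's potential \<open>\<Phi>\<^sub>k = g z\<^sub>k - g z\<^sub>s + \<gamma>\<^sub>k/2 |v\<^sub>k - z\<^sub>s|\<^sup>2\<close> decreases by the
  factor \<open>1 - \<theta>\<^sub>k\<close>. The constant \<open>L / 4\<close>, instead of the familiar \<open>L / 2\<close>, comes from keeping
  \<open>L - \<mu> = L (1 - s) (1 + s)\<close> for the initial gradient step and the exact factor \<open>1 - \<theta>\<^sub>1\<close> for the first
  accelerated one; all later factors are bounded by \<open>1 - s\<close> with \<open>s = \<surd>(\<mu>/L)\<close>.\<close>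
theorem apg_linear_rate:
  fixes g :: "'a::euclidean_space \<Rightarrow> real"
  assumes Z: "convex Z" "closed Z" and zs: "zs \<in> Z" and \<mu>: "0 < \<mu>" "\<mu> < L"
    and upper: "\<And>y w. g w \<le> g y + grad g y \<bullet> (w - y) + L / 2 * (norm (w - y))\<^sup>2"
    and lower: "\<And>y w. g y + grad g y \<bullet> (w - y) + \<mu> / 2 * (norm (w - y))\<^sup>2 \<le> g w"
    and min: "\<And>w. w \<in> Z \<Longrightarrow> g zs \<le> g w"
    and l: "2 \<le> l"
  shows "g (fst (apg_iter \<mu> L Z g z0 l)) - g zs
    \<le> (1 - sqrt (\<mu> / L)) ^ (l - 1) * (L / 4) * (norm (z0 - zs))\<^sup>2"
proof -
  define \<kappa> where "\<kappa> = L / \<mu>"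
  have \<kappa>: "1 < \<kappa>" using \<mu> by (simp add: \<kappa>_def)
  define s where "s = sqrt (inverse \<kappa>)"
  have L: "0 < L" using \<mu> by simp
  have s: "0 < s" "s < 1" and s2: "s\<^sup>2 = \<mu> / L" "s = sqrt (\<mu> / L)"
    using \<mu> \<kappa> by (auto simp: s_def \<kappa>_def field_simps)
  define \<theta> where "\<theta> k = apg_theta \<kappa> k" for k
  define z where "z k = fst (apg_iter \<mu> L Z g z0 k)" for k
  define v where "v k = snd (apg_iter \<mu> L Z g z0 k)" for k
  define \<gamma> where "\<gamma> k = apg_gamma \<mu> L k" for k
  define y where "y k = z k + (\<theta> k * \<gamma> k / (\<gamma> k + \<mu> * \<theta> k)) *\<^sub>R (v k - z k)" for k
  have z_Suc: "z (Suc k) = closest_point Z (y k - inverse L *\<^sub>R grad g (y k))"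
    and v_Suc: "v (Suc k) = z k + inverse (\<theta> k) *\<^sub>R (z (Suc k) - z k)" for k
    by (simp_all add: z_def v_def y_def \<theta>_def \<gamma>_def \<kappa>_def Let_def case_prod_beta)
  have \<theta>: "s < \<theta> k" "\<theta> k \<le> 1" "0 < \<theta> k" for k
    using apg_theta_bounds[OF \<kappa>, of k] s(1) unfolding \<theta>_def s_def by linarith+
  have \<gamma>_Suc: "\<gamma> (Suc k) = (\<theta> k)\<^sup>2 * L" for k by (simp add: \<gamma>_def apg_gamma_def \<theta>_def \<kappa>_def)
  have step: "g (z (Suc k)) + L / 2 * (norm (z (Suc k) - w))\<^sup>2
      \<le> g w + (L - \<mu>) / 2 * (norm (w - y k))\<^sup>2" if "w \<in> Z" for k w
    using projected_gradient_step[where g = g, OF Z that L z_Suc upper lower] .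
  have zZ: "z (Suc k) \<in> Z" for k
    unfolding z_Suc using closest_point_in_set[of Z] Z zs by blast
  define \<Phi> where "\<Phi> k = g (z k) - g zs + \<gamma> k / 2 * (norm (v k - zs))\<^sup>2" for k
  have \<Phi>_nonneg: "0 \<le> \<Phi> (Suc k)" for k
    using min[OF zZ, of k] L by (simp add: \<Phi>_def \<gamma>_Suc)
  \<comment> \<open>since \<open>\<gamma> 0 = 0\<close>, the first step is a plain projected gradient step from \<open>z0\<close>\<close>
  have \<Phi>1: "\<Phi> 1 \<le> (L - \<mu>) / 2 * (norm (z0 - zs))\<^sup>2"
  proof -
    have "y 0 = z0" "z 0 = z0" "\<theta> 0 = 1" by (simp_all add: y_def z_def \<gamma>_def apg_gamma_def \<theta>_def)
    then have "v 1 = z 1" "\<gamma> 1 = L" using v_Suc[of 0] \<gamma>_Suc[of 0] by simp_all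
    then show ?thesis using step[OF zs, of 0] \<open>y 0 = z0\<close> by (simp add: \<Phi>_def norm_minus_commute)
  qed
  have \<Phi>_Suc: "\<Phi> (Suc (Suc k)) \<le> (1 - \<theta> (Suc k)) * \<Phi> (Suc k)" for k
  proof -
    let ?k = "Suc k"
    let ?t = "\<theta> ?k" and ?g = "\<gamma> ?k"
    \<comment> \<open>the comparison point for which \<open>z (Suc ?k) - w\<close> is a multiple of \<open>v (Suc ?k) - zs\<close>\<close>
    define w where "w = (1 - ?t) *\<^sub>R z ?k + ?t *\<^sub>R zs"
    have w: "w \<in> Z" unfolding w_def
      using Z(1) zZ zs \<theta>[of ?k] by (intro convexD) auto
    have vw: "z (Suc ?k) - w = ?t *\<^sub>R (v (Suc ?k) - zs)"
      using \<theta>(3)[of ?k] by (simp add: v_Suc w_def algebra_simps)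
    have yw: "y ?k - w = (?t * ?g / (?g + \<mu> * ?t)) *\<^sub>R (v ?k - zs)
        + (?t - ?t * ?g / (?g + \<mu> * ?t)) *\<^sub>R (z ?k - zs)"
      by (simp add: y_def w_def algebra_simps)
    have rec: "?t\<^sup>2 * L = (1 - ?t) * ?g + \<mu> * ?t"
    proof -
      have 1: "?t\<^sup>2 = (1 - ?t) * (\<theta> k)\<^sup>2 + inverse \<kappa> * ?t"
        unfolding \<theta>_def by (rule apg_theta_rec[OF \<kappa>])
      have 2: "inverse \<kappa> * L = \<mu>" using \<mu> by (simp add: \<kappa>_def)
      have "?t\<^sup>2 * L = (1 - ?t) * ((\<theta> k)\<^sup>2 * L) + inverse \<kappa> * L * ?t"
        unfolding 1 by (simp only: distrib_right distrib_left mult_ac)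
      then show ?thesis by (simp only: 2 \<gamma>_Suc)
    qed
    have "g (z (Suc ?k)) + L / 2 * (?t\<^sup>2 * (norm (v (Suc ?k) - zs))\<^sup>2)
        \<le> g w + (L - \<mu>) / 2 * (norm (y ?k - w))\<^sup>2"
      using step[OF w, of ?k] unfolding vw norm_minus_commute[of w]
      by (simp only: norm_scaleR power_mult_distrib power2_abs)
    also have "g w \<le> (1 - ?t) * g (z ?k) + ?t * g zs - \<mu> / 2 * (?t * (1 - ?t)) * (norm (z ?k - zs))\<^sup>2"
      using strongly_convex_segment[OF _ _ w_def lower[of w]] \<theta>[of ?k] by simp
    also have "(L - \<mu>) / 2 * (norm (y ?k - w))\<^sup>2
        \<le> (1 - ?t) * (?g * (norm (v ?k - zs))\<^sup>2 + \<mu> * ?t * (norm (z ?k - zs))\<^sup>2) / 2"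
      using apg_extrapolation_bound[OF _ \<mu>(1) \<theta>(3) rec \<theta>(2), of "v ?k - zs" "z ?k - zs"] L
      by (simp add: yw \<gamma>_Suc)
    finally show ?thesis
      by (simp add: \<Phi>_def \<gamma>_Suc add_divide_distrib diff_divide_distrib algebra_simps)
  qed
  have decay: "\<Phi> (Suc (Suc k)) \<le> (1 - s) ^ k * ((1 - \<theta> 1) * \<Phi> 1)" for k
  proof (induction k)
    case 0
    then show ?case using \<Phi>_Suc[of 0] by simp
  next
    case (Suc k)
    have "\<Phi> (Suc (Suc (Suc k))) \<le> (1 - s) * \<Phi> (Suc (Suc k))"
      using \<Phi>_Suc[of "Suc k"] \<theta>(1)[of "Suc (Suc k)"]
        mult_right_mono[OF _ \<Phi>_nonneg, of "1 - \<theta> (Suc (Suc k))" "1 - s" "Suc k"] by linarith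
    also have "\<dots> \<le> (1 - s) * ((1 - s) ^ k * ((1 - \<theta> 1) * \<Phi> 1))"
      using Suc s by (intro mult_left_mono) auto
    finally show ?case by simp
  qed
  obtain j where j: "l = Suc (Suc j)" using l by (metis Suc_le_D numeral_2_eq_2 Suc_le_mono)
  have "g (z l) - g zs \<le> \<Phi> l" using L by (simp add: \<Phi>_def j \<gamma>_Suc)
  also have "\<dots> \<le> (1 - s) ^ j * ((1 - \<theta> 1) * \<Phi> 1)" unfolding j by (rule decay)
  also have "\<dots> \<le> (1 - s) ^ j * ((1 - \<theta> 1) * ((L - \<mu>) / 2 * (norm (z0 - zs))\<^sup>2))"
    using \<Phi>1 \<theta>[of 1] s by (intro mult_left_mono) auto
  also have "\<dots> = (1 - s) ^ j * (1 - s) * ((1 + s) * (1 - \<theta> 1)) * (L / 2) * (norm (z0 - zs))\<^sup>2"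
  proof -
    have "L - \<mu> = L * ((1 - s) * (1 + s))"
    proof -
      have "(1 - s) * (1 + s) = 1 - s\<^sup>2" by (simp add: power2_eq_square algebra_simps)
      then show ?thesis using L s2(1) by (simp add: field_simps)
    qed
    then show ?thesis by (simp add: mult_ac)
  qed
  also have "\<dots> \<le> (1 - s) ^ j * (1 - s) * (1 / 2) * (L / 2) * (norm (z0 - zs))\<^sup>2"
    using apg_theta_1[OF \<kappa>] s L by (intro mult_right_mono mult_left_mono) (auto simp: \<theta>_def s_def)
  also have "(1 - s) ^ j * (1 - s) = (1 - s) ^ (l - 1)" by (simp add: j)
  finally show ?thesis unfolding z_def[symmetric] s2(2)[symmetric] by simp
qed

text \<open>Here every projected gradient step returns the minimizer, from wherever it is taken; in particular the
  extrapolation, whose parameters degenerate to zero in this case, does not matter.\<close>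
theorem apg_exact_if_perfectly_conditioned:
  fixes g :: "'a::euclidean_space \<Rightarrow> real"
  assumes Z: "convex Z" "closed Z" and zs: "zs \<in> Z" and L: "0 < L"
    and upper: "\<And>y w. g w \<le> g y + grad g y \<bullet> (w - y) + L / 2 * (norm (w - y))\<^sup>2"
    and lower: "\<And>y w. g y + grad g y \<bullet> (w - y) + L / 2 * (norm (w - y))\<^sup>2 \<le> g w"
    and min: "\<And>w. w \<in> Z \<Longrightarrow> g zs \<le> g w"
    and l: "0 < l"
  shows "fst (apg_iter L L Z g z0 l) = zs"
proof -
  have exact: "closest_point Z (y - inverse L *\<^sub>R grad g y) = zs" for y
  proof -
    define z' where "z' = closest_point Z (y - inverse L *\<^sub>R grad g y)"
    have "g z' + L / 2 * (norm (z' - zs))\<^sup>2 \<le> g zs + (L - L) / 2 * (norm (zs - y))\<^sup>2"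
      using projected_gradient_step[where g = g, OF Z zs L z'_def upper lower] .
    moreover have "g zs \<le> g z'"
      unfolding z'_def using min closest_point_in_set[of Z] Z zs by blast
    ultimately have "L * (norm (z' - zs))\<^sup>2 \<le> 0" by simp
    then have "z' = zs" using L by (simp add: mult_le_0_iff)
    then show ?thesis by (simp add: z'_def)
  qed
  show ?thesis using l by (cases l) (simp_all add: Let_def case_prod_beta exact)
qed

section \<open>The scalar small-gain inequality\<close>

text \<open>In this section \<open>s\<close>, \<open>d\<close> and \<open>X\<close> stand for the norms of a state, of its optimal input sequence and of
  its successor under the optimal input. The weight \<open>r\<close> of the state must satisfy
  \<open>(r + a) X + d \<le> r s\<close>, and \<open>1 + (r + a) \<sigma>\<close> must not exceed the reciprocal of the contraction factor of
  the optimizer. For small \<open>a\<close> it suffices to use \<open>X \<le> b s\<close> and \<open>d \<le> a s\<close> separately: then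
  \<open>r + a = 2 a / (1 - b)\<close>, and for \<open>\<sigma> = 1\<close> the last bound is tight precisely when the assumption on \<open>a\<close> is.\<close>
lemma small_gain_crude:
  fixes a b :: real
  assumes "0 \<le> b" "b < 1" "0 \<le> a" and h: "a * (1 - 7/5 * b) \<le> 1/5 * (1 - b)"
    and \<sigma>: "0 \<le> \<sigma>" "\<sigma> \<le> 1"
  defines "r \<equiv> a * (1 + b) / (1 - b)"
  shows "0 \<le> r" "(r + a) * b + a \<le> r"
    "1 + (r + a) * \<sigma> \<le> 7/5 * (1 + 2 * a * \<sigma> * (b / (1 - b)))"
proof -
  have b: "1 - b > 0" using assms by simp
  have ra: "r + a = 2 * a / (1 - b)" using b by (simp add: r_def field_simps)
  show "0 \<le> r" using assms by (simp add: r_def)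
  have "(r + a) * b + a = r" using b by (simp add: ra) (simp add: r_def field_simps)
  then show "(r + a) * b + a \<le> r" by simp
  have "\<sigma> * (a * (1 - 7/5 * b)) \<le> \<sigma> * (1/5 * (1 - b))" using h \<sigma> by (intro mult_left_mono) auto
  also have "\<dots> \<le> 1 * (1/5 * (1 - b))" using \<sigma> b by (intro mult_right_mono) auto
  finally have "\<sigma> * (a * (1 - 7/5 * b)) \<le> 1/5 * (1 - b)" by simp
  then have "2 * (\<sigma> * (a * (1 - 7/5 * b))) / (1 - b) \<le> 2/5" using b by (simp add: pos_divide_le_eq)
  moreover have "(r + a) * \<sigma> - 7/5 * (2 * a * \<sigma> * (b / (1 - b))) = 2 * (\<sigma> * (a * (1 - 7/5 * b))) / (1 - b)"
  proof -
    define u where "u = inverse (1 - b)"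
    have u: "x / (1 - b) = x * u" for x by (simp add: u_def divide_inverse)
    show ?thesis unfolding ra u by (simp add: algebra_simps)
  qed
  ultimately show "1 + (r + a) * \<sigma> \<le> 7/5 * (1 + 2 * a * \<sigma> * (b / (1 - b)))" by (simp add: distrib_left)
qed

lemma cauchy_schwarz_2:
  fixes x y u v :: real
  shows "(x * u + y * v)\<^sup>2 \<le> (x\<^sup>2 + y\<^sup>2) * (u\<^sup>2 + v\<^sup>2)"
proof -
  have "(x\<^sup>2 + y\<^sup>2) * (u\<^sup>2 + v\<^sup>2) - (x * u + y * v)\<^sup>2 = (x * v - y * u)\<^sup>2"
    by (simp add: power2_eq_square algebra_simps)
  then show ?thesis by (metis diff_ge_0_iff_ge zero_le_power2)
qed

text \<open>For large \<open>a\<close> the joint bound on \<open>X\<close> and \<open>d\<close> is used through the Cauchy-Schwarz inequality. There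
  \<open>a\<close> may be replaced by its upper bound \<open>A = b / c\<close>, and the weight
  \<open>r\<close> solves \<open>((r + A)\<^sup>2 + 1 / c\<^sup>2) b\<^sup>2 = r\<^sup>2\<close>. The final bound reduces to a claim about \<open>b\<close> alone: the left-hand
  side minus the right-hand side is affine in \<open>a\<close>. Where it decreases, namely for \<open>b \<ge> 5/19\<close>, the lower bound on
  \<open>a\<close> is inserted, and otherwise the upper bound \<open>A\<close>.\<close>
lemma small_gain_refined:
  fixes a b c :: real
  assumes b: "0 < b" "b < 1" and c: "0 < c" "c\<^sup>2 = 1 - b\<^sup>2" and a: "0 \<le> a" "a * c \<le> b"
    and h: "1/5 * (1 - b) < a * (1 - 7/5 * b)" and \<sigma>: "0 \<le> \<sigma>" "\<sigma> \<le> 1"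
  defines "r \<equiv> b * (1 + b\<^sup>2) / c ^ 3"
  shows "0 < r"
    "\<lbrakk>0 \<le> X; 0 \<le> s; X\<^sup>2 + c\<^sup>2 * d\<^sup>2 \<le> b\<^sup>2 * s\<^sup>2\<rbrakk> \<Longrightarrow> (r + a) * X + d \<le> r * s"
    "1 + (r + a) * \<sigma> \<le> 7/5 * (1 + 2 * a * \<sigma> * (b / (1 - b)))"
proof -
  define A where "A = b / c"
  have aA: "a \<le> A" using a c by (simp add: A_def field_simps)
  have c3: "c ^ 3 = c * c\<^sup>2" by (simp add: power3_eq_cube power2_eq_square)
  have c2: "0 < 1 - b\<^sup>2" using c by (metis zero_less_power)
  show r0: "0 < r" using b c by (simp add: r_def add_pos_nonneg)
  have rA: "r + A = 2 * b / c ^ 3"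
  proof -
    have "A = b * c\<^sup>2 / c ^ 3" using c(1) by (simp add: A_def c3)
    then have "r + A = b * (1 + b\<^sup>2 + c\<^sup>2) / c ^ 3" by (simp add: r_def add_divide_distrib[symmetric] distrib_left)
    then show ?thesis by (simp add: c(2))
  qed
  show "(r + a) * X + d \<le> r * s" if X: "0 \<le> X" and s: "0 \<le> s" and XD: "X\<^sup>2 + c\<^sup>2 * d\<^sup>2 \<le> b\<^sup>2 * s\<^sup>2"
  proof -
    have "((r + A) * X + 1 / c * (c * d))\<^sup>2 \<le> ((r + A)\<^sup>2 + (1 / c)\<^sup>2) * (X\<^sup>2 + (c * d)\<^sup>2)"
      by (rule cauchy_schwarz_2)
    also have "\<dots> \<le> ((r + A)\<^sup>2 + (1 / c)\<^sup>2) * (b\<^sup>2 * s\<^sup>2)"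
      using XD by (intro mult_left_mono) (simp_all add: power_mult_distrib)
    also have "\<dots> = (((r + A)\<^sup>2 + (1 / c)\<^sup>2) * b\<^sup>2) * s\<^sup>2" by simp
    also have "((r + A)\<^sup>2 + (1 / c)\<^sup>2) * b\<^sup>2 = r\<^sup>2"
    proof -
      have "(1 / c)\<^sup>2 = (c\<^sup>2)\<^sup>2 / (c ^ 3)\<^sup>2" using c(1) by (simp add: c3 power2_eq_square)
      then have "(r + A)\<^sup>2 + (1 / c)\<^sup>2 = (4 * b\<^sup>2 + (1 - b\<^sup>2)\<^sup>2) / (c ^ 3)\<^sup>2"
        unfolding rA c(2) by (simp add: power_divide power_mult_distrib add_divide_distrib)
      also have "4 * b\<^sup>2 + (1 - b\<^sup>2)\<^sup>2 = (1 + b\<^sup>2)\<^sup>2" by (simp add: power2_eq_square algebra_simps)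
      finally show ?thesis by (simp add: r_def power_divide power_mult_distrib)
    qed
    finally have "((r + A) * X + d)\<^sup>2 \<le> (r * s)\<^sup>2" using c(1) by (simp add: power_mult_distrib)
    then have "(r + A) * X + d \<le> r * s" by (rule power2_le_imp_le) (use r0 s in simp)
    moreover have "(r + a) * X \<le> (r + A) * X" using aA X by (intro mult_right_mono) auto
    ultimately show ?thesis by linarith
  qed
  have b1: "1 - b > 0" using b by simp
  have "1 - 7/5 * b > 0"
  proof (rule ccontr)
    assume "\<not> ?thesis"
    then have "a * (1 - 7/5 * b) \<le> 0" using a by (simp add: mult_nonneg_nonpos)
    then show False using h b by simp
  qed
  then have b57: "b < 5/7" by simp
  define k where "k = 1 - 7/5 * b"
  have k: "k > 0" using b57 by (simp add: k_def)
  have main: "r + a * ((1 - 19/5 * b) / (1 - b)) \<le> 2/5"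
  proof (cases "1 \<le> 19/5 * b")
    case True
    have "1/5 / k \<le> a / (1 - b)"
      using h k b1 unfolding k_def[symmetric] by (simp add: field_simps)
    then have "(19/5 * b - 1) * (1/5 / k) \<le> (19/5 * b - 1) * (a / (1 - b))"
      using True by (intro mult_left_mono) auto
    then have 1: "a * ((1 - 19/5 * b) / (1 - b)) \<le> - ((19/5 * b - 1) * (1/5 / k))"
      by (simp add: diff_divide_distrib algebra_simps)
    have b2: "b\<^sup>2 \<le> 4/5"
    proof -
      have "b\<^sup>2 \<le> (5/7)\<^sup>2" using b b57 by (intro power_mono) auto
      then show ?thesis by (simp add: power2_eq_square)
    qed
    define x where "x = b\<^sup>2"
    have x: "0 \<le> x" "x \<le> 4/5" using b2 by (auto simp: x_def)
    \<comment> \<open>the binomial series of \<open>\<surd>(1 - x)\<close>, with its coefficient 1/8 raised to 1/4 to obtain a lower bound\<close>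
    have "1 - x / 2 - x\<^sup>2 / 4 \<le> c"
    proof (rule power2_le_imp_le)
      have "1 - x - (1 - x / 2 - x\<^sup>2 / 4)\<^sup>2 = x\<^sup>2 / 4 * (1 - x - x\<^sup>2 / 4)"
        by (simp add: power2_eq_square field_simps)
      moreover have "x\<^sup>2 \<le> 4/5 * x" using x mult_right_mono[of x "4/5" x] by (simp add: power2_eq_square)
      then have "x\<^sup>2 / 4 * (1 - x - x\<^sup>2 / 4) \<ge> 0" using x by (intro mult_nonneg_nonneg) auto
      ultimately show "(1 - x / 2 - x\<^sup>2 / 4)\<^sup>2 \<le> c\<^sup>2" using c(2) by (simp add: x_def)
    qed (use c in simp)
    then have "1 - b\<^sup>2 / 2 - b ^ 4 / 4 \<le> c" by (simp add: x_def)
    then have "1/5 * (1 + b) * (1 - b\<^sup>2) * (1 - b\<^sup>2 / 2 - b ^ 4 / 4) \<le> 1/5 * (1 + b) * (1 - b\<^sup>2) * c"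
      using b c2 by (intro mult_left_mono) auto
    moreover have "b * (1 + b\<^sup>2) * k \<le> 1/5 * (1 + b) * (1 - b\<^sup>2) * (1 - b\<^sup>2 / 2 - b ^ 4 / 4)"
    proof -
      \<comment> \<open>a certificate of positivity for \<open>b > 0\<close>\<close>
      have "1/5 * (1 + b) * (1 - b\<^sup>2) * (1 - b\<^sup>2 / 2 - b ^ 4 / 4) - b * (1 + b\<^sup>2) * k
          = ((2 - 4 * b - b\<^sup>2 / 2)\<^sup>2 + b\<^sup>2 * (8 * (1 - 15/8 * b)\<^sup>2 + 5/8 * b\<^sup>2) + b ^ 5 + b ^ 6 + b ^ 7) / 20"
        by (simp add: k_def power2_eq_square eval_nat_numeral field_simps)
      also have "\<dots> \<ge> 0" using b by (intro divide_nonneg_nonneg add_nonneg_nonneg mult_nonneg_nonneg) auto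
      finally show ?thesis by (simp only: diff_ge_0_iff_ge)
    qed
    ultimately have "b * (1 + b\<^sup>2) * k \<le> 1/5 * (1 + b) * (1 - b\<^sup>2) * c" by (rule order_trans[rotated])
    also have "\<dots> = 1/5 * (1 + b) * c ^ 3" by (simp add: c3 c(2))
    finally have "b * (1 + b\<^sup>2) * k \<le> 1/5 * (1 + b) * c ^ 3" .
    then have "r \<le> 1/5 * (1 + b) / k" using c k by (simp add: r_def field_simps)
    then have "r + a * ((1 - 19/5 * b) / (1 - b)) \<le> 1/5 * (1 + b) / k - (19/5 * b - 1) * (1/5 / k)"
      using 1 by linarith
    also have "\<dots> = (1/5 * (1 + b) - (19/5 * b - 1) * (1/5)) / k" by (simp add: diff_divide_distrib)
    also have "1/5 * (1 + b) - (19/5 * b - 1) * (1/5) = 2/5 * k" unfolding k_def by argo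
    finally show ?thesis using k by simp
  next
    case False
    have inv: "1 / (1 - b) = (1 + b) / c\<^sup>2"
    proof -
      have "c\<^sup>2 = (1 - b) * (1 + b)" unfolding c(2) by (simp add: power2_eq_square algebra_simps)
      then show ?thesis using b by simp
    qed
    have "a * ((1 - 19/5 * b) / (1 - b)) \<le> A * ((1 - 19/5 * b) / (1 - b))"
      using aA False b by (intro mult_right_mono divide_nonneg_nonneg) auto
    also have "\<dots> = A * (1 - 19/5 * b) * (1 / (1 - b))" by simp
    also have "\<dots> = b * ((1 - 19/5 * b) * (1 + b)) / c ^ 3" unfolding inv by (simp add: A_def c3)
    finally have "r + a * ((1 - 19/5 * b) / (1 - b)) \<le> r + b * ((1 - 19/5 * b) * (1 + b)) / c ^ 3" by simp
    also have "\<dots> = b * (2 - 14/5 * b - 14/5 * b\<^sup>2) / c ^ 3"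
      by (simp add: r_def add_divide_distrib[symmetric] power2_eq_square algebra_simps)
    also have "\<dots> \<le> 2/5"
    proof -
      have "b \<le> 5/19" using False by simp
      then have b2: "b\<^sup>2 \<le> 25/361" using power_mono[of b "5/19" 2] b by (simp add: power2_eq_square)
      have "c\<^sup>2 \<le> 1" using c by simp
      then have "c \<le> 1" using c(1) by (simp add: power2_le_imp_le)
      then have "c\<^sup>2 \<le> c" using c(1) by (simp add: power2_eq_square)
      then have "c * c\<^sup>2 \<ge> c\<^sup>2 * c\<^sup>2" by (intro mult_right_mono) simp_all
      \<comment> \<open>\<open>336/361 = 1 - (5/19)\<^sup>2\<close>\<close>
      moreover have "c\<^sup>2 * c\<^sup>2 \<ge> (336/361) * (336/361)" using c(2) b2 by (intro mult_mono) auto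
      ultimately have "c ^ 3 \<ge> 43/50" unfolding c3 by simp
      have "(5/19 - b) * (2 - 14/5 * (b + 5/19)) \<ge> 0" using \<open>b \<le> 5/19\<close> by (intro mult_nonneg_nonneg) auto
      then have "b * (2 - 14/5 * b) \<le> 5/19 * (2 - 14/19)" by (simp add: field_simps)
      have "b * (2 - 14/5 * b - 14/5 * b\<^sup>2) = b * (2 - 14/5 * b) - b * (14/5 * b\<^sup>2)"
        by (simp only: right_diff_distrib)
      also have "\<dots> \<le> b * (2 - 14/5 * b)" using b by simp
      also have "\<dots> \<le> 5/19 * (2 - 14/19)" by fact
      also have "\<dots> \<le> 2/5 * (43/50)" by simp
      also have "\<dots> \<le> 2/5 * c ^ 3" using \<open>43/50 \<le> c ^ 3\<close> by simp
      finally have "b * (2 - 14/5 * b - 14/5 * b\<^sup>2) \<le> 2/5 * c ^ 3" .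
      then show ?thesis using c by (simp add: pos_divide_le_eq)
    qed
    finally show ?thesis .
  qed
  define u where "u = b / (1 - b)"
  have "r + a - 7/5 * (2 * a * u) = r + a * ((1 - 19/5 * b) / (1 - b))"
    unfolding u_def using b1 by (simp add: field_simps)
  with main have "r + a - 7/5 * (2 * a * u) \<le> 2/5" by (simp only:)
  then have "\<sigma> * (r + a - 7/5 * (2 * a * u)) \<le> \<sigma> * (2/5)" using \<sigma>(1) by (rule mult_left_mono)
  also have "\<dots> \<le> 2/5" using \<sigma> by simp
  finally show "1 + (r + a) * \<sigma> \<le> 7/5 * (1 + 2 * a * \<sigma> * (b / (1 - b)))"
    unfolding u_def[symmetric] by (simp add: algebra_simps)
qed

text \<open>The two cases combined, with a common decay factor \<open>\<rho> < 1\<close>: the assumption on \<open>\<eta>\<close> is strict, which leaves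
  room to enlarge the weight by some \<open>\<delta> > 0\<close>, and since \<open>X \<le> b s\<close> with \<open>b < 1\<close> this makes the other estimate
  strict as well. The constant 7/5 has to be less than \<open>\<surd>2\<close>, which is what the optimizer provides.\<close>
lemma small_gain:
  fixes a b \<sigma> \<eta> :: real
  assumes b: "0 \<le> b" "b < 1" and a: "0 \<le> a" "a\<^sup>2 * (1 - b\<^sup>2) \<le> b\<^sup>2" and \<sigma>: "0 \<le> \<sigma>" "\<sigma> \<le> 1"
    and \<eta>: "0 < \<eta>" "\<eta> * (7/5 * (1 + 2 * a * \<sigma> * (b / (1 - b)))) < 1"
  obtains r \<rho> where "0 < r" "0 \<le> \<rho>" "\<rho> < 1"
    "\<And>X s d. \<lbrakk>0 \<le> X; 0 \<le> s; d \<le> a * s; X\<^sup>2 + (1 - b\<^sup>2) * d\<^sup>2 \<le> b\<^sup>2 * s\<^sup>2\<rbrakk>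
      \<Longrightarrow> (r + a) * X + d \<le> \<rho> * (r * s)"
    "1 + (r + a) * \<sigma> \<le> \<rho> * (1 / \<eta>)"
proof -
  have b2: "0 < 1 - b\<^sup>2" using b by (simp add: abs_square_less_1)
  obtain r0 where r0: "0 \<le> r0"
    "\<And>X s d. \<lbrakk>0 \<le> X; 0 \<le> s; d \<le> a * s; X\<^sup>2 + (1 - b\<^sup>2) * d\<^sup>2 \<le> b\<^sup>2 * s\<^sup>2\<rbrakk>
      \<Longrightarrow> (r0 + a) * X + d \<le> r0 * s"
    "1 + (r0 + a) * \<sigma> \<le> 7/5 * (1 + 2 * a * \<sigma> * (b / (1 - b)))"
  proof (cases "a * (1 - 7/5 * b) \<le> 1/5 * (1 - b)")
    case True
    note C = small_gain_crude[OF b a(1) True \<sigma>]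
    let ?r = "a * (1 + b) / (1 - b)"
    show ?thesis
    proof (rule that[OF C(1) _ C(3)])
      fix X s d :: real
      assume X: "0 \<le> X" "0 \<le> s" "d \<le> a * s" "X\<^sup>2 + (1 - b\<^sup>2) * d\<^sup>2 \<le> b\<^sup>2 * s\<^sup>2"
      have "0 \<le> (1 - b\<^sup>2) * d\<^sup>2" using b2 by simp
      then have "X\<^sup>2 \<le> (b * s)\<^sup>2" using X(4) by (simp add: power_mult_distrib)
      then have "X \<le> b * s" by (rule power2_le_imp_le) (use X b in simp)
      then have "(?r + a) * X \<le> (?r + a) * (b * s)" using C(1) a by (intro mult_left_mono) auto
      moreover have "((?r + a) * b + a) * s \<le> ?r * s" using C(2) X by (intro mult_right_mono) auto
      ultimately show "(?r + a) * X + d \<le> ?r * s" using X(3) by (simp add: algebra_simps)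
    qed
  next
    case False
    define c where "c = sqrt (1 - b\<^sup>2)"
    have c: "0 < c" "c\<^sup>2 = 1 - b\<^sup>2" using b2 by (auto simp: c_def)
    have "b \<noteq> 0"
    proof
      assume "b = 0"
      then have "a = 0" using a by (simp add: power2_eq_square mult_le_0_iff)
      then show False using False b by simp
    qed
    then have b0: "0 < b" using b by simp
    have "(a * c)\<^sup>2 \<le> b\<^sup>2" using a(2) by (simp add: power_mult_distrib c)
    then have ac: "a * c \<le> b" by (rule power2_le_imp_le) (use b in simp)
    note C = small_gain_refined[OF b0 b(2) c a(1) ac _ \<sigma>]
    show ?thesis using that[of "b * (1 + b\<^sup>2) / c ^ 3"] C c False by (simp add: less_imp_le)
  qed
  define \<delta> where "\<delta> = (1 / \<eta> - (1 + (r0 + a) * \<sigma>)) / 2"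
  have \<delta>: "0 < \<delta>"
  proof -
    have "7/5 * (1 + 2 * a * \<sigma> * (b / (1 - b))) < 1 / \<eta>" using \<eta> by (simp add: field_simps)
    then show ?thesis using r0(3) by (simp add: \<delta>_def)
  qed
  define r where "r = r0 + \<delta>"
  have r: "0 < r" using r0 \<delta> by (simp add: r_def)
  have lt: "1 + (r + a) * \<sigma> < 1 / \<eta>"
  proof -
    have "(r + a) * \<sigma> = (r0 + a) * \<sigma> + \<delta> * \<sigma>" by (simp add: r_def algebra_simps)
    moreover have "\<delta> * \<sigma> \<le> \<delta>" using \<delta> \<sigma> by (simp add: mult_left_le)
    moreover have "1 / \<eta> = 1 + (r0 + a) * \<sigma> + 2 * \<delta>" unfolding \<delta>_def by argo
    ultimately show ?thesis using \<delta> by linarith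
  qed
  define \<rho>1 where "\<rho>1 = (r0 + \<delta> * b) / r"
  define \<rho>2 where "\<rho>2 = (1 + (r + a) * \<sigma>) * \<eta>"
  have 1: "\<rho>1 < 1" "0 \<le> \<rho>1" using r r0 \<delta> b by (auto simp: \<rho>1_def r_def)
  have 2: "\<rho>2 < 1" using lt \<eta> by (simp add: \<rho>2_def field_simps)
  show ?thesis
  proof (rule that[of r "max \<rho>1 \<rho>2"])
    show "1 + (r + a) * \<sigma> \<le> max \<rho>1 \<rho>2 * (1 / \<eta>)"
    proof -
      have "\<rho>2 * (1 / \<eta>) \<le> max \<rho>1 \<rho>2 * (1 / \<eta>)" using \<eta> by (intro mult_right_mono) auto
      then show ?thesis using \<eta> by (simp add: \<rho>2_def)
    qed
    fix X s d :: real
    assume X: "0 \<le> X" "0 \<le> s" "d \<le> a * s" "X\<^sup>2 + (1 - b\<^sup>2) * d\<^sup>2 \<le> b\<^sup>2 * s\<^sup>2"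
    have "0 \<le> (1 - b\<^sup>2) * d\<^sup>2" using b2 by simp
    then have "X\<^sup>2 \<le> (b * s)\<^sup>2" using X(4) by (simp add: power_mult_distrib)
    then have "X \<le> b * s" by (rule power2_le_imp_le) (use X b in simp)
    then have "\<delta> * X \<le> \<delta> * (b * s)" using \<delta> by simp
    moreover have "(r + a) * X + d = ((r0 + a) * X + d) + \<delta> * X" by (simp add: r_def algebra_simps)
    ultimately have "(r + a) * X + d \<le> r0 * s + \<delta> * (b * s)" using r0(2)[OF X] by linarith
    also have "\<dots> = \<rho>1 * (r * s)" using r by (simp add: \<rho>1_def field_simps)
    also have "\<dots> \<le> max \<rho>1 \<rho>2 * (r * s)" using r X by (intro mult_right_mono) auto
    finally show "(r + a) * X + d \<le> max \<rho>1 \<rho>2 * (r * s)" .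
  qed (use r 1 2 in auto)
qed

section \<open>The condensed cost as the cost of a trajectory\<close>

primrec rollout :: "real^'n^'n \<Rightarrow> real^'m^'n \<Rightarrow> real^'n \<Rightarrow> (nat \<Rightarrow> real^'m) \<Rightarrow> nat \<Rightarrow> real^'n" where
  "rollout A B x u 0 = x"
| "rollout A B x u (Suc t) = A *v rollout A B x u t + B *v u t"

definition block :: "real^('s::finite \<times> 'c::finite) \<Rightarrow> 's \<Rightarrow> real^'c" where
  "block y s = (\<chi> a. y $ (s, a))"

text \<open>Indexed by time instead of stages, to match trajectories; only times below the horizon are meaningful.\<close>
definition inputs :: "real^('h::{finite,linorder} \<times> 'm::finite) \<Rightarrow> nat \<Rightarrow> real^'m" where
  "inputs z t = block z (inv input_stage t)"

lemma input_stage_bij: "bij_betw (input_stage :: 'h::{finite,linorder} \<Rightarrow> nat) UNIV {..<CARD('h)}"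
proof -
  have mono: "input_stage i < input_stage j" if "i < j" for i j :: 'h
  proof -
    have "{k. k < i} \<subset> {k. k < j}" using that by auto
    then show ?thesis unfolding input_stage_def by (intro psubset_card_mono) auto
  qed
  have inj: "inj (input_stage :: 'h \<Rightarrow> nat)"
    by (rule linorder_injI) (use mono in force)
  have "input_stage j < CARD('h)" for j :: 'h
    unfolding input_stage_def by (intro psubset_card_mono) auto
  then have "range (input_stage :: 'h \<Rightarrow> nat) \<subseteq> {..<CARD('h)}" by auto
  moreover have "card (range (input_stage :: 'h \<Rightarrow> nat)) = CARD('h)" by (rule card_image[OF inj])
  ultimately have "range (input_stage :: 'h \<Rightarrow> nat) = {..<CARD('h)}" by (intro card_subset_eq) auto
  then show ?thesis using inj by (simp add: bij_betw_def)
qed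

lemma inj_input_stage: "inj (input_stage :: 'h::{finite,linorder} \<Rightarrow> nat)"
  by (rule bij_betw_imp_inj_on[OF input_stage_bij])

lemma input_stage_less: "input_stage (j :: 'h::{finite,linorder}) < CARD('h)"
  using bij_betw_apply[OF input_stage_bij, of j] by simp

lemma input_stage_cover:
  assumes "t < CARD('h)"
  obtains j :: "'h::{finite,linorder}" where "input_stage j = t"
  using assms bij_betw_imp_surj_on[OF input_stage_bij[where ?'h = 'h]] by (metis imageE lessThan_iff)

lemma inputs_input_stage:
  fixes z :: "real^('h::{finite,linorder} \<times> 'm::finite)"
  shows "inputs z (input_stage j) = block z j"
  by (simp add: inputs_def inv_f_f[OF inj_input_stage])

lemma sum_input_stage:
  fixes f :: "nat \<Rightarrow> 'b::comm_monoid_add"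
  shows "(\<Sum>j\<in>(UNIV::'h::{finite,linorder} set). f (input_stage j)) = (\<Sum>t<CARD('h). f t)"
  by (rule sum.reindex_bij_betw[OF input_stage_bij])

lemma sum_prod_UNIV:
  fixes f :: "'s::finite \<times> 'c::finite \<Rightarrow> 'b::comm_monoid_add"
  shows "(\<Sum>p\<in>UNIV. f p) = (\<Sum>s\<in>UNIV. \<Sum>c\<in>UNIV. f (s, c))"
  using sum.cartesian_product[of "\<lambda>s c. f (s, c)" UNIV UNIV] by simp

lemma inner_blocks:
  fixes y w :: "real^('s::finite \<times> 'c::finite)"
  shows "y \<bullet> w = (\<Sum>s\<in>UNIV. block y s \<bullet> block w s)"
  by (simp add: inner_vec_def block_def sum_prod_UNIV)

text \<open>Variation of constants; the summands are the blocks of the prediction matrices.\<close>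
lemma rollout_explicit:
  "rollout A B x u t = mat_pow A t *v x + (\<Sum>s<t. (mat_pow A (t - 1 - s) ** B) *v u s)"
proof (induction t)
  case (Suc t)
  have "A *v (\<Sum>s<t. (mat_pow A (t - 1 - s) ** B) *v u s) = (\<Sum>s<t. (mat_pow A (t - s) ** B) *v u s)"
    unfolding linear_sum[OF matrix_vector_mul_linear, unfolded o_def]
  proof (rule sum.cong)
    fix s assume "s \<in> {..<t}"
    then have "t - s = Suc (t - 1 - s)" by auto
    then show "A *v ((mat_pow A (t - 1 - s) ** B) *v u s) = (mat_pow A (t - s) ** B) *v u s"
      by (simp add: matrix_vector_mul_assoc matrix_mul_assoc)
  qed simp
  then show ?case
    by (simp add: Suc matrix_vector_right_distrib matrix_vector_mul_assoc)
qed simp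

lemma block_A_hat:
  "block (A_hat A *v x) s = mat_pow A (state_stage s) *v x"
  by (simp add: block_def A_hat_def matrix_vector_mult_def vec_eq_iff)

lemma block_B_hat:
  fixes z :: "real^('h::{finite,linorder} \<times> 'm::finite)"
  shows "block (B_hat A B *v z) s
    = (\<Sum>t<state_stage s. (mat_pow A (state_stage s - 1 - t) ** B) *v inputs z t)"
proof -
  let ?i = "state_stage s"
  let ?M = "\<lambda>t. mat_pow A (?i - 1 - t) ** B"
  have le: "?i \<le> CARD('h)"
    by (cases s) (simp_all add: state_stage_def less_imp_le[OF input_stage_less])
  have "block (B_hat A B *v z) s $ a = (\<Sum>t<?i. ?M t *v inputs z t) $ a" for a
  proof -
    have "block (B_hat A B *v z) s $ a
        = (\<Sum>j\<in>UNIV. \<Sum>c\<in>UNIV. (if input_stage j < ?i then ?M (input_stage j) $ a $ c else 0) * z $ (j, c))"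
      by (simp add: block_def B_hat_def matrix_vector_mult_def sum_prod_UNIV Let_def cong: if_cong)
    also have "\<dots> = (\<Sum>j\<in>(UNIV::'h set). if input_stage j < ?i
        then (?M (input_stage j) *v inputs z (input_stage j)) $ a else 0)"
      by (intro sum.cong) (auto simp: matrix_vector_mult_def inputs_input_stage block_def)
    also have "\<dots> = (\<Sum>t<CARD('h). if t < ?i then (?M t *v inputs z t) $ a else 0)"
      by (rule sum_input_stage)
    also have "\<dots> = (\<Sum>t<?i. (?M t *v inputs z t) $ a)"
      using le by (intro sum.mono_neutral_cong_right) auto
    finally show ?thesis by simp
  qed
  then show ?thesis by (simp add: vec_eq_iff)
qed

lemma block_add: "block (y + w) s = block y s + block w s"
  by (simp add: block_def vec_eq_iff)

lemma block_prediction: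
  fixes z :: "real^('h::{finite,linorder} \<times> 'm::finite)"
  shows "block (A_hat A *v x + B_hat A B *v z) s = rollout A B x (inputs z) (state_stage s)"
  by (simp only: block_add block_A_hat block_B_hat rollout_explicit)

lemma sum_delta_block:
  fixes f g :: "'s::finite \<Rightarrow> 'c::finite \<Rightarrow> real"
  shows "(\<Sum>s'\<in>UNIV. \<Sum>c\<in>UNIV. (if s = s' then f s' c else 0) * g s' c) = (\<Sum>c\<in>UNIV. f s c * g s c)"
proof -
  have "(\<Sum>c\<in>UNIV. (if s = s' then f s' c else 0) * g s' c)
      = (if s' = s then \<Sum>c\<in>UNIV. f s c * g s c else 0)" for s'
    by auto
  then show ?thesis by simp
qed

lemma block_H_hat:
  "block (H_hat Q P *v y) s = (case s of Some _ \<Rightarrow> Q | None \<Rightarrow> P) *v block y s"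
  by (cases s) (simp_all add: block_def H_hat_def matrix_vector_mult_def sum_prod_UNIV sum_delta_block
      vec_eq_iff cong: if_cong)

lemma block_kron_id:
  "block (kron (mat 1) R *v z) j = R *v block z j"
proof -
  have "(\<Sum>s\<in>UNIV. \<Sum>c\<in>UNIV. (if j = s then 1 else 0) * R $ a $ c * z $ (s, c))
      = (\<Sum>c\<in>UNIV. R $ a $ c * z $ (j, c))" for a
    using sum_delta_block[of j "\<lambda>_ c. R $ a $ c" "\<lambda>s c. z $ (s, c)"]
    by (simp add: if_distrib[of "\<lambda>x. x * _"] cong: if_cong)
  then show ?thesis
    by (simp add: block_def kron_def mat_def matrix_vector_mult_def sum_prod_UNIV vec_eq_iff)
qed

lemma H_hat_symmetric:
  assumes "transpose Q = Q" "transpose P = P"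
  shows "transpose (H_hat Q P) = H_hat Q P"
proof (rule symmetricI)
  fix x y
  show "(H_hat Q P *v x) \<bullet> y = x \<bullet> (H_hat Q P *v y)"
    unfolding inner_blocks block_H_hat
    by (intro sum.cong) (auto simp: inner_mult_sym assms split: option.split)
qed

text \<open>The cost without the detour through the square root of a weighted norm; the two agree where this
  expression is nonnegative.\<close>
definition quad_cost :: "real^'p^'p \<Rightarrow> real^'n^'p \<Rightarrow> real^'n^'n \<Rightarrow> real^'p \<Rightarrow> real^'n \<Rightarrow> real" where
  "quad_cost H G W z x = z \<bullet> (H *v z) + 2 * (z \<bullet> (G *v x)) + x \<bullet> (W *v x)"

lemma sum_option_UNIV:
  fixes f :: "'s::finite option \<Rightarrow> 'b::comm_monoid_add"
  shows "(\<Sum>s\<in>UNIV. f s) = f None + (\<Sum>i\<in>UNIV. f (Some i))"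
  unfolding UNIV_option_conv by (subst sum.insert) (auto simp: sum.reindex)

text \<open>The block vector \<open>A_hat A x + B_hat A B z\<close> lists the predicted states, so the block diagonal weights
  produce the stage costs and the terminal cost. Symmetry of the weights merges the two mixed terms.\<close>
lemma condensed_cost:
  fixes z :: "real^('h::{finite,linorder} \<times> 'm::finite)" and x :: "real^'n"
  assumes sym: "transpose Q = Q" "transpose P = P"
  shows "quad_cost (H_mat A B Q R P) (G_mat A B Q P) (W_mat TYPE('h) A Q P) z x
    = (\<Sum>t<CARD('h). rollout A B x (inputs z) t \<bullet> (Q *v rollout A B x (inputs z) t)
          + inputs z t \<bullet> (R *v inputs z t))
      + rollout A B x (inputs z) CARD('h) \<bullet> (P *v rollout A B x (inputs z) CARD('h))"
proof -
  let ?a = "A_hat A *v x :: real^('h option \<times> 'n)"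
  let ?b = "B_hat A B *v z"
  let ?K = "kron (mat 1) R :: real^('h \<times> 'm)^('h \<times> 'm)"
  let ?x = "rollout A B x (inputs z)"
  note assoc = matrix_vector_mul_assoc[symmetric]
  have "z \<bullet> (H_mat A B Q R P *v z) = ?b \<bullet> (H_hat Q P *v ?b) + z \<bullet> (?K *v z)"
    unfolding H_mat_def matrix_vector_mult_add_rdistrib inner_add_right assoc inner_transpose_mult' ..
  moreover have "z \<bullet> (G_mat A B Q P *v x) = ?b \<bullet> (H_hat Q P *v ?a)"
    unfolding G_mat_def assoc inner_transpose_mult' ..
  moreover have "x \<bullet> (W_mat TYPE('h) A Q P *v x) = ?a \<bullet> (H_hat Q P *v ?a)"
    unfolding W_mat_def assoc inner_transpose_mult' ..
  moreover have "?a \<bullet> (H_hat Q P *v ?b) = ?b \<bullet> (H_hat Q P *v ?a)"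
    using inner_mult_sym[OF H_hat_symmetric[OF sym], of ?a ?b] by (simp add: inner_commute)
  ultimately have "quad_cost (H_mat A B Q R P) (G_mat A B Q P) (W_mat TYPE('h) A Q P) z x
      = (?a + ?b) \<bullet> (H_hat Q P *v (?a + ?b)) + z \<bullet> (?K *v z)"
    by (simp add: quad_cost_def matrix_vector_right_distrib inner_add_left inner_add_right)
  also have "(?a + ?b) \<bullet> (H_hat Q P *v (?a + ?b))
      = ?x CARD('h) \<bullet> (P *v ?x CARD('h)) + (\<Sum>i\<in>(UNIV::'h set). ?x (input_stage i) \<bullet> (Q *v ?x (input_stage i)))"
    unfolding inner_blocks block_H_hat block_prediction sum_option_UNIV
    by (simp add: state_stage_def)
  also have "(\<Sum>i\<in>(UNIV::'h set). ?x (input_stage i) \<bullet> (Q *v ?x (input_stage i)))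
      = (\<Sum>t<CARD('h). ?x t \<bullet> (Q *v ?x t))"
    by (rule sum_input_stage)
  also have "z \<bullet> (?K *v z) = (\<Sum>i\<in>(UNIV::'h set). inputs z (input_stage i) \<bullet> (R *v inputs z (input_stage i)))"
    unfolding inner_blocks block_kron_id inputs_input_stage ..
  also have "\<dots> = (\<Sum>t<CARD('h). inputs z t \<bullet> (R *v inputs z t))"
    by (rule sum_input_stage)
  finally show ?thesis by (simp add: sum.distrib)
qed

lemma stack_quadratic_form:
  fixes H :: "real^'p^'p" and G :: "real^'n^'p"
  shows "stack z x \<bullet> (M_mat H G W *v stack z x) = quad_cost H G W z x"
proof -
  have split: "(\<Sum>i\<in>UNIV. f i) = (\<Sum>a\<in>UNIV. f (Inl a)) + (\<Sum>b\<in>UNIV. f (Inr b))"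
    for f :: "'p + 'n \<Rightarrow> real"
    unfolding UNIV_Plus_UNIV[symmetric] by (subst sum.Plus) auto
  have 1: "(M_mat H G W *v stack z x) $ Inl a = (H *v z + G *v x) $ a" for a
    by (simp add: matrix_vector_mult_def M_mat_def stack_def split)
  have 2: "(M_mat H G W *v stack z x) $ Inr b = (transpose G *v z + W *v x) $ b" for b
    unfolding matrix_vector_mult_def by (simp add: M_mat_def stack_def split)
  have "stack z x \<bullet> (M_mat H G W *v stack z x) = z \<bullet> (H *v z + G *v x) + x \<bullet> (transpose G *v z + W *v x)"
    unfolding inner_vec_def split 1 2 by (simp add: stack_def)
  moreover have "x \<bullet> (transpose G *v z) = z \<bullet> (G *v x)"
    using inner_transpose_mult[of G z x] by (simp add: inner_commute)
  ultimately show ?thesis by (simp add: quad_cost_def inner_add_right)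
qed

lemma cost_eq_quad_cost:
  assumes "0 \<le> quad_cost H G W z x"
  shows "cost H G W z x = quad_cost H G W z x"
  using assms by (simp add: cost_def weighted_norm_def stack_quadratic_form)

text \<open>Expanding the left-hand side gives a quadratic polynomial in \<open>u\<close> with leading matrix
  \<open>S = R + B\<^sup>T P B\<close> and mixed term \<open>B\<^sup>T P A\<close>. Completing the square leaves exactly the right-hand side of
  the Riccati equation as the form in \<open>x\<close>. The gain \<open>K\<close> is that of the linear-quadratic regulator.\<close>
lemma riccati_completion:
  fixes A P Q :: "real^'n^'n" and B :: "real^'m^'n" and R :: "real^'m^'m"
  assumes R: "pos_def R" and P: "pos_def P"
    and ric: "P = Q + transpose A ** P ** A
           - (transpose A ** P ** B) ** matrix_inv (R + transpose B ** P ** B)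
               ** (transpose B ** P ** A)"
  obtains S :: "real^'m^'m" and K :: "real^'n^'m" where "\<And>w. 0 \<le> w \<bullet> (S *v w)"
    "\<And>x u. x \<bullet> (Q *v x) + u \<bullet> (R *v u) + (A *v x + B *v u) \<bullet> (P *v (A *v x + B *v u))
      = x \<bullet> (P *v x) + (u + K *v x) \<bullet> (S *v (u + K *v x))"
proof -
  define S where "S = R + transpose B ** P ** B"
  define C where "C = transpose B ** P ** A"
  define K where "K = matrix_inv S ** C"
  note assoc = matrix_vector_mul_assoc[symmetric]
  have symP: "transpose P = P" and symR: "transpose R = R" using P R by (auto simp: pos_def_def)
  have Sform: "v \<bullet> (S *v w) = v \<bullet> (R *v w) + (B *v v) \<bullet> (P *v (B *v w))" for v w
    unfolding S_def assoc matrix_vector_mult_add_rdistrib inner_add_right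
    by (simp only: inner_transpose_mult')
  have Cform: "v \<bullet> (C *v x) = (B *v v) \<bullet> (P *v (A *v x))" for v x
    unfolding C_def assoc
    by (rule inner_transpose_mult')
  have symS: "transpose S = S"
  proof (rule symmetricI)
    fix v w
    have "(S *v v) \<bullet> w = w \<bullet> (S *v v)" by (rule inner_commute)
    also have "\<dots> = v \<bullet> (S *v w)"
      unfolding Sform using inner_mult_sym[OF symR, of w v] inner_mult_sym[OF symP, of "B *v w" "B *v v"]
      by (metis inner_commute)
    finally show "(S *v v) \<bullet> w = v \<bullet> (S *v w)" .
  qed
  have posS: "pos_def S"
    unfolding pos_def_def
  proof (intro conjI allI impI symS)
    fix v :: "real^'m" assume "v \<noteq> 0"
    then have "0 < v \<bullet> (R *v v)" using R by (simp add: pos_def_def)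
    moreover have "0 \<le> (B *v v) \<bullet> (P *v (B *v v))"
      using P by (cases "B *v v = 0") (auto simp: pos_def_def less_imp_le)
    ultimately show "0 < v \<bullet> (S *v v)" by (simp add: Sform)
  qed
  have SK: "S *v (K *v x) = C *v x" for x
    unfolding K_def assoc by (rule pos_def_inv_cancel(2)[OF posS])
  have ricx: "x \<bullet> (P *v x) = x \<bullet> (Q *v x) + (A *v x) \<bullet> (P *v (A *v x)) - (K *v x) \<bullet> (S *v (K *v x))" for x
  proof -
    have "transpose C = transpose A ** P ** B"
      by (simp add: C_def matrix_transpose_mul symP matrix_mul_assoc)
    then have "P = Q + transpose A ** P ** A - transpose C ** K"
      using ric by (simp add: K_def S_def[symmetric] C_def[symmetric] matrix_mul_assoc)
    from arg_cong[where f = "\<lambda>M. M *v x", OF this]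
    have "P *v x = Q *v x + transpose A *v (P *v (A *v x)) - transpose C *v (K *v x)"
      unfolding matrix_vector_mult_add_rdistrib matrix_vector_mult_diff_rdistrib assoc .
    then have "x \<bullet> (P *v x) = x \<bullet> (Q *v x) + x \<bullet> (transpose A *v (P *v (A *v x)))
        - x \<bullet> (transpose C *v (K *v x))" by (simp add: inner_add_right inner_diff_right)
    moreover have "x \<bullet> (transpose A *v (P *v (A *v x))) = (A *v x) \<bullet> (P *v (A *v x))"
      by (rule inner_transpose_mult')
    moreover have "x \<bullet> (transpose C *v (K *v x)) = (K *v x) \<bullet> (S *v (K *v x))"
      unfolding inner_transpose_mult' SK[symmetric] by (rule inner_commute)
    ultimately show ?thesis by simp
  qed
  show ?thesis
  proof (rule that[of S K])
    show "0 \<le> w \<bullet> (S *v w)" for w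
      using posS by (cases "w = 0") (auto simp: pos_def_def less_imp_le)
    fix x :: "real^'n" and u :: "real^'m"
    have c1: "(A *v x) \<bullet> (P *v (B *v u)) = (B *v u) \<bullet> (P *v (A *v x))"
      by (metis inner_mult_sym[OF symP] inner_commute)
    have c2: "(K *v x) \<bullet> (S *v u) = u \<bullet> (C *v x)"
      by (metis inner_mult_sym[OF symS] inner_commute SK)
    have e1: "(A *v x + B *v u) \<bullet> (P *v (A *v x + B *v u))
        = (A *v x) \<bullet> (P *v (A *v x)) + 2 * ((B *v u) \<bullet> (P *v (A *v x))) + (B *v u) \<bullet> (P *v (B *v u))"
      unfolding matrix_vector_right_distrib inner_add_left inner_add_right c1 by simp
    have "(u + K *v x) \<bullet> (S *v (u + K *v x))
        = u \<bullet> (S *v u) + 2 * (u \<bullet> (C *v x)) + (K *v x) \<bullet> (C *v x)"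
      unfolding matrix_vector_right_distrib inner_add_left inner_add_right SK c2 by simp
    then show "x \<bullet> (Q *v x) + u \<bullet> (R *v u) + (A *v x + B *v u) \<bullet> (P *v (A *v x + B *v u))
      = x \<bullet> (P *v x) + (u + K *v x) \<bullet> (S *v (u + K *v x))"
      unfolding ricx[of x] e1 SK Sform[of u u] Cform[of u x] by simp
  qed
qed

lemma telescoped_cost:
  fixes V :: "'x \<Rightarrow> real"
  assumes "\<And>t. c t + V (y (Suc t)) = V (y t) + e t"
  shows "(\<Sum>t<n. c t) + V (y n) = V (y 0) + (\<Sum>t<n. e t)"
proof (induction n)
  case (Suc n)
  then show ?case using assms[of n] by simp
qed simp

lemma first_block_mult:
  fixes z :: "real^('h::{finite,linorder} \<times> 'm::finite)"
  shows "first_block *v z = inputs z 0"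
proof -
  obtain j0 :: 'h where j0: "input_stage j0 = 0"
    using input_stage_cover[of 0, where ?'h = 'h] by auto
  have eq: "input_stage j = 0 \<longleftrightarrow> j = j0" for j :: 'h
    using inj_input_stage[where ?'h = 'h] j0 by (metis injD)
  have "(first_block *v z) $ a = inputs z (input_stage j0) $ a" for a
  proof -
    have "(first_block *v z) $ a
        = (\<Sum>j\<in>UNIV. \<Sum>c\<in>UNIV. (if j0 = j then if c = a then 1 else 0 else 0) * z $ (j, c))"
      unfolding first_block_def matrix_vector_mult_def sum_prod_UNIV by (auto simp: eq intro!: sum.cong)
    also have "\<dots> = (\<Sum>c\<in>UNIV. (if c = a then 1 else 0) * z $ (j0, c))" by (rule sum_delta_block)
    also have "\<dots> = z $ (j0, a)" by (simp add: if_distrib[of "\<lambda>x. x * _"] cong: if_cong)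
    finally show ?thesis by (simp add: inputs_input_stage block_def)
  qed
  then show ?thesis by (simp add: vec_eq_iff j0)
qed

text \<open>Summed along a trajectory, the completed squares telescope: the cost is \<open>|x|\<^sub>P\<^sup>2\<close> plus a sum of nonnegative
  terms, all of which vanish for the linear-quadratic regulator. Keeping only the term of the first stage
  gives the second bound, in which the cost of all later stages is replaced by \<open>|x'|\<^sub>P\<^sup>2\<close>.\<close>
theorem value_function_bounds:
  fixes A P Q :: "real^'n^'n" and B :: "real^'m^'n" and R :: "real^'m^'m"
    and z :: "real^('h::{finite,linorder} \<times> 'm::finite)"
  assumes R: "pos_def R" and P: "pos_def P" and Q: "pos_def Q"
    and ric: "P = Q + transpose A ** P ** A
           - (transpose A ** P ** B) ** matrix_inv (R + transpose B ** P ** B)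
               ** (transpose B ** P ** A)"
  defines "q \<equiv> quad_cost (H_mat A B Q R P :: real^('h \<times> 'm)^('h \<times> 'm)) (G_mat A B Q P) (W_mat TYPE('h) A Q P)"
  shows "x \<bullet> (P *v x) \<le> q z x"
    "x \<bullet> (Q *v x) + (A *v x + (B ** first_block) *v z) \<bullet> (P *v (A *v x + (B ** first_block) *v z)) \<le> q z x"
    "\<exists>z. q z x = x \<bullet> (P *v x)"
    "z \<noteq> 0 \<Longrightarrow> 0 < q z 0"
proof -
  obtain S :: "real^'m^'m" and K :: "real^'n^'m" where S: "\<And>w. 0 \<le> w \<bullet> (S *v w)"
    and SK: "\<And>x u. x \<bullet> (Q *v x) + u \<bullet> (R *v u) + (A *v x + B *v u) \<bullet> (P *v (A *v x + B *v u))
      = x \<bullet> (P *v x) + (u + K *v x) \<bullet> (S *v (u + K *v x))"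
    using riccati_completion[OF R P ric] by metis
  define e where "e x u = (u + K *v x) \<bullet> (S *v (u + K *v x))" for x u
  have e: "0 \<le> e x u" for x u unfolding e_def by (rule S)
  have sym: "transpose Q = Q" "transpose P = P" using P Q by (auto simp: pos_def_def)
  have qe: "q z x = x \<bullet> (P *v x) + (\<Sum>t<CARD('h). e (rollout A B x (inputs z) t) (inputs z t))" for z x
    using telescoped_cost[where V = "\<lambda>x. x \<bullet> (P *v x)" and y = "rollout A B x (inputs z)" and
        c = "\<lambda>t. rollout A B x (inputs z) t \<bullet> (Q *v rollout A B x (inputs z) t) + inputs z t \<bullet> (R *v inputs z t)"
        and e = "\<lambda>t. e (rollout A B x (inputs z) t) (inputs z t)" and n = "CARD('h)"]
      SK by (simp add: q_def condensed_cost[OF sym] e_def)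
  show "x \<bullet> (P *v x) \<le> q z x" using e by (simp add: qe sum_nonneg)
  have "e x (inputs z 0) \<le> (\<Sum>t<CARD('h). e (rollout A B x (inputs z) t) (inputs z t))"
    using member_le_sum[of 0 "{..<CARD('h)}" "\<lambda>t. e (rollout A B x (inputs z) t) (inputs z t)"] e by simp
  moreover have "0 \<le> inputs z 0 \<bullet> (R *v inputs z 0)"
    using R by (cases "inputs z 0 = 0") (auto simp: pos_def_def less_imp_le)
  ultimately show "x \<bullet> (Q *v x) + (A *v x + (B ** first_block) *v z) \<bullet> (P *v (A *v x + (B ** first_block) *v z)) \<le> q z x"
    using SK[of x "inputs z 0"]
    by (simp add: qe e_def first_block_mult flip: matrix_vector_mul_assoc)
  show "\<exists>z. q z x = x \<bullet> (P *v x)"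
  proof -
    define y where "y t = mat_pow (A - B ** K) t *v x" for t
    define z :: "real^('h \<times> 'm)" where "z = (\<chi> i. (- (K *v y (input_stage (fst i)))) $ snd i)"
    have "block z j = - (K *v y (input_stage j))" for j
      by (simp add: z_def block_def vec_eq_iff)
    then have u: "inputs z t = - (K *v y t)" if "t < CARD('h)" for t
      using input_stage_cover[OF that] inputs_input_stage[of z] by metis
    have "rollout A B x (inputs z) t = y t" if "t \<le> CARD('h)" for t
      using that
    proof (induction t)
      case (Suc t)
      then have "rollout A B x (inputs z) (Suc t) = A *v y t + B *v (- (K *v y t))" by (simp add: u)
      also have "\<dots> = (A - B ** K) *v y t"
        using matrix_vector_mult_diff_distrib[of B 0 "K *v y t"]
        by (simp add: matrix_vector_mult_diff_rdistrib matrix_vector_mul_assoc)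
      also have "\<dots> = y (Suc t)" by (simp add: y_def matrix_vector_mul_assoc)
      finally show ?case .
    qed (simp add: y_def)
    then have "q z x = x \<bullet> (P *v x)" by (simp add: qe u e_def)
    then show ?thesis by blast
  qed
  show "0 < q z 0" if "z \<noteq> 0"
  proof -
    have "\<exists>j. block z j \<noteq> 0"
      using that by (auto simp: block_def vec_eq_iff) 
    then obtain j where "block z j \<noteq> 0" by blast
    then have j: "inputs z (input_stage j) \<noteq> 0" by (simp add: inputs_input_stage)
    have psd: "0 \<le> v \<bullet> (M *v v)" if "pos_def M" for M :: "real^'k^'k" and v
      using that by (cases "v = 0") (auto simp: pos_def_def less_imp_le)
    let ?x = "rollout A B 0 (inputs z)"
    have "0 < inputs z (input_stage j) \<bullet> (R *v inputs z (input_stage j))"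
      using R j by (simp add: pos_def_def)
    also have "\<dots> \<le> (\<Sum>t<CARD('h). inputs z t \<bullet> (R *v inputs z t))"
      using psd[OF R] by (intro member_le_sum) (simp_all add: input_stage_less)
    also have "\<dots> \<le> (\<Sum>t<CARD('h). ?x t \<bullet> (Q *v ?x t) + inputs z t \<bullet> (R *v inputs z t))"
      using psd[OF Q] by (intro sum_mono) simp
    also have "\<dots> \<le> q z 0" using psd[OF P] by (simp add: q_def condensed_cost[OF sym])
    finally show ?thesis .
  qed
qed

section \<open>Local Lyapunov functions\<close>

text \<open>The sublevel set \<open>{s. V s \<le> rad}\<close> is invariant, and inside it \<open>V\<close> decays geometrically; this controls the
  distance because \<open>V\<close> is equivalent to it.\<close>
lemma asymptotically_stable_if_local_lyapunov:
  fixes F :: "'s::metric_space \<Rightarrow> 's" and V :: "'s \<Rightarrow> real"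
  assumes p: "p \<in> D" and c: "0 < c1" "0 < c2"
    and V: "\<And>s. c1 * dist s p \<le> V s" "\<And>s. V s \<le> c2 * dist s p"
    and rad: "0 < rad" and \<rho>: "0 \<le> \<rho>" "\<rho> < 1"
    and decr: "\<And>s. V s \<le> rad \<Longrightarrow> V (F s) \<le> \<rho> * V s"
  shows "asymptotically_stable F D p"
proof -
  have V0: "0 \<le> V s" for s
    using V(1)[of s] c by (meson less_imp_le order_trans mult_nonneg_nonneg zero_le_dist)
  have iter: "V ((F ^^ k) s) \<le> \<rho> ^ k * V s" if s: "V s \<le> rad" for s k
  proof (induction k)
    case (Suc k)
    have "\<rho> ^ k * V s \<le> 1 * V s" using \<rho> V0 by (intro mult_right_mono power_le_one) auto
    then have "V ((F ^^ k) s) \<le> rad" using Suc s by linarith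
    then have "V ((F ^^ Suc k) s) \<le> \<rho> * V ((F ^^ k) s)" using decr by simp
    also have "\<dots> \<le> \<rho> * (\<rho> ^ k * V s)" using Suc \<rho> by (intro mult_left_mono) auto
    finally show ?case by (simp add: mult.assoc)
  qed simp
  have near: "V s < e" if "dist s p < e / c2" for s e
    using that V(2)[of s] c by (simp add: field_simps)
  have bound: "dist ((F ^^ k) s) p \<le> \<rho> ^ k * (V s / c1)" if "V s \<le> rad" for s k
  proof -
    have "c1 * dist ((F ^^ k) s) p \<le> \<rho> ^ k * V s" using iter[OF that, of k] V(1) order_trans by blast
    then show ?thesis using c by (simp add: field_simps)
  qed
  show ?thesis
    unfolding asymptotically_stable_def
  proof (intro conjI p allI impI)
    fix \<epsilon> :: real assume \<epsilon>: "\<epsilon> > 0"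
    define e where "e = min rad (c1 * \<epsilon>)"
    have e: "0 < e" "e \<le> rad" "e \<le> c1 * \<epsilon>" using rad \<epsilon> c by (auto simp: e_def)
    show "\<exists>\<delta>>0. \<forall>s\<in>D. dist s p < \<delta> \<longrightarrow> (\<forall>k. dist ((F ^^ k) s) p < \<epsilon>)"
    proof (intro exI[of _ "e / c2"] conjI ballI impI allI)
      fix s k assume "dist s p < e / c2"
      then have "V s < e" by (rule near)
      then have "dist ((F ^^ k) s) p \<le> \<rho> ^ k * (V s / c1)" using bound e by auto
      also have "\<dots> \<le> 1 * (V s / c1)" using \<rho> V0 c by (intro mult_right_mono power_le_one) auto
      also have "\<dots> < \<epsilon>" using \<open>V s < e\<close> e c by (simp add: field_simps)
      finally show "dist ((F ^^ k) s) p < \<epsilon>" .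
    qed (use e c in simp)
  next
    show "\<exists>\<delta>>0. \<forall>s\<in>D. dist s p < \<delta> \<longrightarrow> (\<lambda>k. (F ^^ k) s) \<longlonglongrightarrow> p"
    proof (intro exI[of _ "rad / c2"] conjI ballI impI)
      fix s assume "dist s p < rad / c2"
      then have "V s \<le> rad" using near by (simp add: less_imp_le)
      then have b: "dist ((F ^^ k) s) p \<le> \<rho> ^ k * (V s / c1)" for k by (rule bound)
      have lim: "(\<lambda>k. \<rho> ^ k * (V s / c1)) \<longlonglongrightarrow> 0"
        using \<rho> by (intro tendsto_mult_left_zero LIMSEQ_power_zero) simp
      have ub: "\<forall>\<^sub>F k in sequentially. dist ((F ^^ k) s) p \<le> \<rho> ^ k * (V s / c1)"
        by (intro always_eventually allI b)
      have lb: "\<forall>\<^sub>F k in sequentially. 0 \<le> dist ((F ^^ k) s) p" by simp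
      have "(\<lambda>k. dist ((F ^^ k) s) p) \<longlonglongrightarrow> 0"
        by (rule tendsto_sandwich[OF lb ub tendsto_const lim])
      then show "(\<lambda>k. (F ^^ k) s) \<longlonglongrightarrow> p" by (rule tendsto_dist_iff[THEN iffD2])
    qed (use rad c in simp)
  qed
qed

section \<open>The optimizer on the condensed cost\<close>

lemma input_seqs_iff: "z \<in> input_seqs U \<longleftrightarrow> (\<forall>j. block z j \<in> U)"
  by (simp add: input_seqs_def block_def)

lemma norm_block_le: "norm (block z j) \<le> norm z"
proof -
  have "(norm (block z j))\<^sup>2 \<le> (\<Sum>j\<in>UNIV. (norm (block z j))\<^sup>2)"
    by (rule member_le_sum) auto
  also have "\<dots> = (norm z)\<^sup>2" by (simp add: power2_norm_eq_inner inner_blocks[of z z])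
  finally show ?thesis by (rule power2_le_imp_le) simp
qed

lemma linear_block: "linear (\<lambda>z. block z j)"
  by (rule linearI) (simp_all add: block_def vec_eq_iff)

lemma input_seqs_regular:
  fixes U :: "(real^'m) set"
  assumes U: "closed U" "convex U" "0 \<in> interior U"
  shows "closed (input_seqs U :: (real^('h::{finite,linorder} \<times> 'm)) set)"
    "convex (input_seqs U :: (real^('h \<times> 'm)) set)"
    "0 \<in> interior (input_seqs U :: (real^('h \<times> 'm)) set)"
proof -
  have eq: "input_seqs U = (\<Inter>j. (\<lambda>z :: real^('h \<times> 'm). block z j) -` U)"
    by (auto simp: input_seqs_iff)
  show "closed (input_seqs U :: (real^('h \<times> 'm)) set)"
    unfolding eq using U(1)
    by (intro closed_INT ballI closed_vimage linear_continuous_on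
        linear_block[unfolded linear_conv_bounded_linear])
  show "convex (input_seqs U :: (real^('h \<times> 'm)) set)"
    unfolding eq using U(2) linear_block by (intro convex_INT convex_linear_vimage) simp_all
  obtain e where e: "0 < e" "ball 0 e \<subseteq> U" using U(3) by (auto simp: mem_interior)
  have "z \<in> input_seqs U" if "norm z < e" for z :: "real^('h \<times> 'm)"
    unfolding input_seqs_iff
  proof
    fix j
    have "norm (block z j) < e" using norm_block_le[of z j] that by linarith
    then show "block z j \<in> U" using e(2) by auto
  qed
  then have "ball 0 e \<subseteq> (input_seqs U :: (real^('h \<times> 'm)) set)" by auto
  then show "0 \<in> interior (input_seqs U :: (real^('h \<times> 'm)) set)" using e(1) by (auto simp: mem_interior)
qed

lemma quad_cost_expand:
  fixes H :: "real^'p^'p"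
  assumes sym: "transpose H = H"
  shows "quad_cost H G W w x
    = quad_cost H G W y x + (2 *\<^sub>R (H *v y + G *v x)) \<bullet> (w - y) + (w - y) \<bullet> (H *v (w - y))"
proof -
  have "y \<bullet> (H *v w) = w \<bullet> (H *v y)" using inner_mult_sym[OF sym, of y w] by (simp add: inner_commute)
  then show ?thesis
    by (simp add: quad_cost_def matrix_vector_mult_diff_distrib inner_add_left inner_diff_left inner_diff_right
        inner_commute[of "H *v y"] inner_commute[of "G *v x"] algebra_simps)
qed

lemma grad_quad_cost:
  fixes H :: "real^'p^'p"
  assumes sym: "transpose H = H"
  shows "grad (\<lambda>z. quad_cost H G W z x) y = 2 *\<^sub>R (H *v y + G *v x)"
proof -
  have lin: "bounded_linear ((*v) H)" by (simp add: linear_conv_bounded_linear[symmetric])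
  have "((\<lambda>z. quad_cost H G W z x) has_derivative
      (\<lambda>h. (y \<bullet> (H *v h) + h \<bullet> (H *v y)) + 2 * (h \<bullet> (G *v x)) + 0)) (at y)"
    unfolding quad_cost_def
    by (intro has_derivative_add has_derivative_inner has_derivative_ident has_derivative_const
        bounded_linear_imp_has_derivative[OF lin] has_derivative_mult_right has_derivative_inner_left)
  moreover have "(\<lambda>h. (y \<bullet> (H *v h) + h \<bullet> (H *v y)) + 2 * (h \<bullet> (G *v x)) + 0)
      = (\<lambda>h. h \<bullet> (2 *\<^sub>R (H *v y + G *v x)))"
  proof
    fix h
    have "y \<bullet> (H *v h) = h \<bullet> (H *v y)" using inner_mult_sym[OF sym, of y h] by (simp add: inner_commute)
    then show "(y \<bullet> (H *v h) + h \<bullet> (H *v y)) + 2 * (h \<bullet> (G *v x)) + 0 = h \<bullet> (2 *\<^sub>R (H *v y + G *v x))"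
      by (simp add: inner_add_right)
  qed
  ultimately have D: "GDERIV (\<lambda>z. quad_cost H G W z x) y :> 2 *\<^sub>R (H *v y + G *v x)"
    by (simp add: gderiv_def)
  show ?thesis
    unfolding grad_def
  proof (rule the_equality)
    fix E assume "GDERIV (\<lambda>z. quad_cost H G W z x) y :> E"
    then have "(\<lambda>h. h \<bullet> E) = (\<lambda>h. h \<bullet> (2 *\<^sub>R (H *v y + G *v x)))"
      using D has_derivative_unique unfolding gderiv_def by blast
    then show "E = 2 *\<^sub>R (H *v y + G *v x)"
      by (metis (no_types) vector_eq_ldot)
  qed (rule D)
qed

text \<open>The excess cost over an unconstrained minimizer is exactly the squared \<open>H\<close>-norm of the distance, and the
  extreme eigenvalues of \<open>2 H\<close> are the constants of strong convexity and smoothness. So the rate for the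
  cost becomes a contraction factor in the \<open>H\<close>-norm, with one factor \<open>\<kappa>\<close> for passing from the Euclidean
  to the \<open>H\<close>-norm of the initial error.\<close>
lemma apg_contraction:
  fixes H :: "real^'p^'p" and G :: "real^'n^'p"
  assumes H: "pos_def H" and Z: "convex Z" "closed Z" and zs: "zs \<in> Z" "H *v zs + G *v x = 0"
    and nonneg: "\<And>z. 0 \<le> quad_cost H G W z x"
  defines "\<kappa> \<equiv> cond_num H"
  shows "\<kappa> = 1 \<Longrightarrow> 0 < l \<Longrightarrow> apg H G W Z l z x = zs"
    "1 < \<kappa> \<Longrightarrow> 2 \<le> l \<Longrightarrow> (apg H G W Z l z x - zs) \<bullet> (H *v (apg H G W Z l z x - zs))
      \<le> (1 - 1 / sqrt \<kappa>) ^ (l - 1) * (\<kappa> / 2) * ((z - zs) \<bullet> (H *v (z - zs)))"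
proof -
  define g where "g z = quad_cost H G W z x" for z
  define \<mu> L where "\<mu> = 2 * lam_min H" and "L = 2 * lam_max H"
  have sym: "transpose H = H" using H by (simp add: pos_def_def)
  have \<mu>: "0 < \<mu>" "\<mu> \<le> L" using pos_def_lam[OF H] by (auto simp: \<mu>_def L_def)
  have \<kappa>: "\<kappa> = L / \<mu>" by (simp add: \<kappa>_def cond_num_def \<mu>_def L_def)
  have "(\<lambda>z. cost H G W z x) = g"
    by (rule ext) (simp only: g_def cost_eq_quad_cost[OF nonneg])
  then have apg: "apg H G W Z l z x = fst (apg_iter \<mu> L Z g z l)"
    by (simp add: apg_def \<mu>_def L_def)
  have expand: "g w = g y + grad g y \<bullet> (w - y) + (w - y) \<bullet> (H *v (w - y))" for w y
    using quad_cost_expand[OF sym, of G W w x y] grad_quad_cost[OF sym, of G W x y]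
    by (simp add: g_def[abs_def])
  have upper: "g w \<le> g y + grad g y \<bullet> (w - y) + L / 2 * (norm (w - y))\<^sup>2" for w y
    using rayleigh_bounds(2)[OF sym, of "w - y"] by (simp add: expand[of w y] L_def power2_norm_eq_inner)
  have lower: "g y + grad g y \<bullet> (w - y) + \<mu> / 2 * (norm (w - y))\<^sup>2 \<le> g w" for w y
    using rayleigh_bounds(1)[OF sym, of "w - y"] by (simp add: expand[of w y] \<mu>_def power2_norm_eq_inner)
  have gap: "g w - g zs = (w - zs) \<bullet> (H *v (w - zs))" for w
    using quad_cost_expand[OF sym, of G W w x zs] by (simp add: g_def zs(2))
  have "0 \<le> v \<bullet> (H *v v)" for v
    using H by (cases "v = 0") (auto simp: pos_def_def less_imp_le)
  then have min: "g zs \<le> g w" for w using gap[of w] by (metis diff_ge_0_iff_ge)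
  show "apg H G W Z l z x = zs" if "\<kappa> = 1" "0 < l"
  proof -
    have eq: "\<mu> = L" using that(1) \<mu> by (simp add: \<kappa>)
    have "0 < L" using \<mu> by simp
    from apg_exact_if_perfectly_conditioned[where g = g, OF Z zs(1) this upper lower[unfolded eq] min that(2)]
    show ?thesis by (simp add: apg eq)
  qed
  show "(apg H G W Z l z x - zs) \<bullet> (H *v (apg H G W Z l z x - zs))
      \<le> (1 - 1 / sqrt \<kappa>) ^ (l - 1) * (\<kappa> / 2) * ((z - zs) \<bullet> (H *v (z - zs)))"
    if "1 < \<kappa>" "2 \<le> l"
  proof -
    have lt: "\<mu> < L" using that(1) \<mu> by (simp add: \<kappa>)
    have s: "sqrt (\<mu> / L) = 1 / sqrt \<kappa>" by (simp add: \<kappa> real_sqrt_divide)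
    have s1: "0 \<le> 1 - 1 / sqrt \<kappa>" using that(1) by simp
    have "(apg H G W Z l z x - zs) \<bullet> (H *v (apg H G W Z l z x - zs))
        \<le> (1 - 1 / sqrt \<kappa>) ^ (l - 1) * (L / 4) * (norm (z - zs))\<^sup>2"
      using apg_linear_rate[where g = g, OF Z zs(1) \<mu>(1) lt upper lower min that(2), of z]
      unfolding gap apg[symmetric] s .
    also have "\<dots> \<le> (1 - 1 / sqrt \<kappa>) ^ (l - 1) * (L / 4) * (2 / \<mu> * ((z - zs) \<bullet> (H *v (z - zs))))"
    proof (rule mult_left_mono)
      show "(norm (z - zs))\<^sup>2 \<le> 2 / \<mu> * ((z - zs) \<bullet> (H *v (z - zs)))"
        using rayleigh_bounds(1)[OF sym, of "z - zs"] \<mu>(1)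
        by (simp add: \<mu>_def power2_norm_eq_inner field_simps)
    qed (use s1 \<mu> in simp)
    also have "\<dots> = (1 - 1 / sqrt \<kappa>) ^ (l - 1) * (\<kappa> / 2) * ((z - zs) \<bullet> (H *v (z - zs)))"
      by (simp add: \<kappa> mult_ac)
    finally show ?thesis .
  qed
qed

text \<open>The lower bound on the iteration count is this inequality after taking logarithms; dividing by the negative
  number \<open>ln (1 - 1 / \<surd>\<kappa>)\<close> reverses it.\<close>
lemma iteration_bound_power:
  fixes \<kappa> c :: real
  assumes \<kappa>: "1 < \<kappa>" and c: "1 \<le> c"
    and l: "1 - 2 * ln (sqrt \<kappa> * c) / ln (1 - 1 / sqrt \<kappa>) < real l"
  shows "2 \<le> l" "(1 - 1 / sqrt \<kappa>) ^ (l - 1) * \<kappa> * c\<^sup>2 < 1"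
proof -
  define t where "t = 1 - 1 / sqrt \<kappa>"
  have t: "0 < t" "t < 1" using \<kappa> by (auto simp: t_def)
  have lt: "ln t < 0" using t by simp
  have "1 < sqrt \<kappa>" using \<kappa> by simp
  then have "1 \<le> sqrt \<kappa> * c" using c mult_mono[of 1 "sqrt \<kappa>" 1 c] by simp
  then have ln0: "0 \<le> ln (sqrt \<kappa> * c)" by simp
  have "0 \<le> - (2 * ln (sqrt \<kappa> * c) / ln t)" using ln0 lt by (simp add: divide_nonneg_neg)
  then have "1 < real l" using l by (simp add: t_def)
  then show l2: "2 \<le> l" by simp
  have "- 2 * ln (sqrt \<kappa> * c) / ln t < real l - 1" using l by (simp add: t_def)
  then have "(real l - 1) * ln t < - 2 * ln (sqrt \<kappa> * c)"
    using neg_divide_less_eq[OF lt, of "- 2 * ln (sqrt \<kappa> * c)" "real l - 1"] by blast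
  moreover have "2 * ln (sqrt \<kappa> * c) = ln (\<kappa> * c\<^sup>2)"
    using \<kappa> c by (simp add: ln_mult ln_sqrt ln_realpow)
  moreover have "(real l - 1) * ln t = ln (t ^ (l - 1))" using t l2 by (simp add: ln_realpow of_nat_diff)
  ultimately have "ln (t ^ (l - 1)) + ln (\<kappa> * c\<^sup>2) < 0" by simp
  then have "ln (t ^ (l - 1) * (\<kappa> * c\<^sup>2)) < 0" using t \<kappa> c by (simp add: ln_mult)
  then have "t ^ (l - 1) * (\<kappa> * c\<^sup>2) < 1" using t \<kappa> c by (subst (asm) ln_less_zero_iff) auto
  then show "(1 - 1 / sqrt \<kappa>) ^ (l - 1) * \<kappa> * c\<^sup>2 < 1" by (simp add: t_def mult.assoc)
qed

section \<open>Stability of the closed loop\<close>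

text \<open>Write \<open>k x = H\<^sup>-\<^sup>1 G x\<close>. One step of the plant together with the
  displacement of the minimizer shrinks \<open>r |x|\<^sub>P + |z + k x|\<^sub>H / \<eta>\<close> to \<open>\<rho>\<close> times its value, where the second term
  of the result, the distance of the old iterate from the new minimizer, is not yet divided by \<open>\<eta>\<close>;
  the optimizer supplies that division. Its contraction is available as long as the minimizer for the
  successor state is feasible, which holds on a sublevel set.\<close>
lemma local_closed_loop_stability:
  fixes A P Q W :: "real^'n^'n" and Bbar :: "real^'p^'n" and H :: "real^'p^'p" and G :: "real^'n^'p"
    and T :: "real^'p \<Rightarrow> real^'n \<Rightarrow> real^'p"
  assumes H: "pos_def H" and P: "pos_def P"
    and Z: "0 \<in> interior Z"
    and b: "0 \<le> b" "b < 1"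
    and a1: "0 \<le> a1" "\<And>x. norm (mat_sqrt H *v (matrix_inv H *v (G *v x))) \<le> a1 * norm (mat_sqrt P *v x)"
    and \<sigma>1: "0 \<le> \<sigma>1" "\<And>e. norm (mat_sqrt P *v (Bbar *v e)) \<le> \<sigma>1 * norm (mat_sqrt H *v e)"
    and dissipative: "\<And>e. norm (mat_sqrt P *v (Bbar *v e)) \<le> norm (mat_sqrt H *v e)"
    and decrease: "\<And>x. (norm (mat_sqrt P *v (A *v x - Bbar *v (matrix_inv H *v (G *v x)))))\<^sup>2
        + (1 - b\<^sup>2) * (norm (mat_sqrt H *v (matrix_inv H *v (G *v x))))\<^sup>2
      \<le> b\<^sup>2 * (norm (mat_sqrt P *v x))\<^sup>2"
    and \<eta>: "0 < \<eta>" "\<eta> * (7/5 * (1 + 2 * a1 * \<sigma>1 * (b / (1 - b)))) < 1"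
    and T: "\<And>z x. - (matrix_inv H *v (G *v x)) \<in> Z \<Longrightarrow>
      norm (mat_sqrt H *v (T z x + matrix_inv H *v (G *v x)))
        \<le> \<eta> * norm (mat_sqrt H *v (z + matrix_inv H *v (G *v x)))"
  shows "asymptotically_stable (closed_loop A Bbar T) (UNIV \<times> Z) (0, 0)"
proof -
  define k where "k x = matrix_inv H *v (G *v x)" for x
  define nP where "nP x = norm (mat_sqrt P *v x)" for x
  define nH where "nH e = norm (mat_sqrt H *v e)" for e
  have k_add: "k (x + y) = k x + k y" for x y by (simp add: k_def matrix_vector_right_distrib)
  have nP_add: "nP (x + y) \<le> nP x + nP y" for x y
    by (simp add: nP_def matrix_vector_right_distrib norm_triangle_ineq)
  have nH_add: "nH (x + y) \<le> nH x + nH y" for x y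
    by (simp add: nH_def matrix_vector_right_distrib norm_triangle_ineq)
  have nH_minus: "nH (- x) = nH x" for x
    using matrix_vector_mult_diff_distrib[of "mat_sqrt H" 0 x] by (simp add: nH_def)
  have nonneg: "0 \<le> nP x" "0 \<le> nH e" for x e by (simp_all add: nP_def nH_def)
  have b2: "0 < 1 - b\<^sup>2" using b by (simp add: abs_square_less_1)
  \<comment> \<open>the given gains are only upper bounds; these are the sharper ones that the other assumptions imply\<close>
  define a where "a = min a1 (b / sqrt (1 - b\<^sup>2))"
  define \<sigma> where "\<sigma> = min \<sigma>1 1"
  have a0: "0 \<le> a" "a \<le> a1" using a1(1) b b2 by (auto simp: a_def)
  have \<sigma>0: "0 \<le> \<sigma>" "\<sigma> \<le> 1" "\<sigma> \<le> \<sigma>1" using \<sigma>1(1) by (auto simp: \<sigma>_def)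
  have a2: "a\<^sup>2 * (1 - b\<^sup>2) \<le> b\<^sup>2"
  proof -
    have "a\<^sup>2 \<le> (b / sqrt (1 - b\<^sup>2))\<^sup>2" using a0(1) by (intro power_mono) (auto simp: a_def)
    then show ?thesis using b2 by (simp add: power_divide field_simps)
  qed
  have \<eta>a: "\<eta> * (7/5 * (1 + 2 * a * \<sigma> * (b / (1 - b)))) < 1"
  proof -
    have "a * \<sigma> \<le> a1 * \<sigma>1" using a0 \<sigma>0 by (intro mult_mono) auto
    then have "2 * (a * \<sigma>) * (b / (1 - b)) \<le> 2 * (a1 * \<sigma>1) * (b / (1 - b))"
      using b by (intro mult_right_mono) auto
    then have "\<eta> * (7/5 * (1 + 2 * (a * \<sigma>) * (b / (1 - b)))) \<le> \<eta> * (7/5 * (1 + 2 * (a1 * \<sigma>1) * (b / (1 - b))))"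
      using \<eta>(1) by (intro mult_left_mono) auto
    then show ?thesis using \<eta>(2) by (simp only: mult.assoc)
  qed
  have decr: "(nP (A *v x - Bbar *v k x))\<^sup>2 + (1 - b\<^sup>2) * (nH (k x))\<^sup>2 \<le> b\<^sup>2 * (nP x)\<^sup>2" for x
    using decrease[of x] by (simp add: nP_def nH_def k_def)
  have ka: "nH (k x) \<le> a * nP x" for x
  proof -
    have "nH (k x) \<le> (b / sqrt (1 - b\<^sup>2)) * nP x"
    proof (rule power2_le_imp_le)
      have "(1 - b\<^sup>2) * (nH (k x))\<^sup>2 \<le> b\<^sup>2 * (nP x)\<^sup>2" using decr[of x] by (smt (verit) zero_le_power2)
      then show "(nH (k x))\<^sup>2 \<le> (b / sqrt (1 - b\<^sup>2) * nP x)\<^sup>2"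
        using b2 by (simp add: power_divide power_mult_distrib field_simps)
    qed (use b b2 nonneg in simp)
    moreover have "nH (k x) \<le> a1 * nP x" using a1(2)[of x] by (simp add: nP_def nH_def k_def)
    ultimately show ?thesis by (simp add: a_def min_def)
  qed
  have \<sigma>e: "nP (Bbar *v e) \<le> \<sigma> * nH e" for e
    using \<sigma>1(2)[of e] dissipative[of e] by (simp add: \<sigma>_def min_def nP_def nH_def)
  obtain r \<rho> where r: "0 < r" and \<rho>: "0 \<le> \<rho>" "\<rho> < 1"
    and gainX: "\<And>X s d. \<lbrakk>0 \<le> X; 0 \<le> s; d \<le> a * s; X\<^sup>2 + (1 - b\<^sup>2) * d\<^sup>2 \<le> b\<^sup>2 * s\<^sup>2\<rbrakk>
      \<Longrightarrow> (r + a) * X + d \<le> \<rho> * (r * s)"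
    and gaine: "1 + (r + a) * \<sigma> \<le> \<rho> * (1 / \<eta>)"
    using small_gain[OF b a0(1) a2 \<sigma>0(1,2) \<eta>(1) \<eta>a] by blast
  define V where "V = (\<lambda>(x, z). r * nP x + nH (z + k x) / \<eta>)"
  have V: "V (x, z) = r * nP x + nH (z + k x) / \<eta>" for x z by (simp add: V_def)

  \<comment> \<open>the estimate of one closed-loop step, up to the contraction of the optimizer\<close>
  have step: "r * nP (A *v x + Bbar *v z) + nH (z + k (A *v x + Bbar *v z)) \<le> \<rho> * V (x, z)" for x z
  proof -
    define e X where "e = nH (z + k x)" and "X = nP (A *v x - Bbar *v k x)"
    have split: "A *v x + Bbar *v z = (A *v x - Bbar *v k x) + Bbar *v (z + k x)"
      by (simp add: matrix_vector_right_distrib)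
    have x': "nP (A *v x + Bbar *v z) \<le> X + \<sigma> * e"
      unfolding split using nP_add[of "A *v x - Bbar *v k x" "Bbar *v (z + k x)"] \<sigma>e[of "z + k x"]
      by (simp add: X_def e_def)
    have "nH (z + k (A *v x + Bbar *v z)) = nH ((z + k x) + (- k x + k (A *v x + Bbar *v z)))" by simp
    also have "\<dots> \<le> e + (nH (- k x) + nH (k (A *v x + Bbar *v z)))"
      unfolding e_def using nH_add[of "z + k x" "- k x + k (A *v x + Bbar *v z)"]
        nH_add[of "- k x" "k (A *v x + Bbar *v z)"] by linarith
    also have "\<dots> \<le> e + (nH (k x) + a * nP (A *v x + Bbar *v z))"
      using ka[of "A *v x + Bbar *v z"] by (simp add: nH_minus)
    finally have "r * nP (A *v x + Bbar *v z) + nH (z + k (A *v x + Bbar *v z))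
        \<le> (r + a) * nP (A *v x + Bbar *v z) + nH (k x) + e" by (simp add: algebra_simps)
    also have "\<dots> \<le> (r + a) * (X + \<sigma> * e) + nH (k x) + e"
      using x' r a0 by (intro add_right_mono mult_left_mono) auto
    also have "\<dots> = ((r + a) * X + nH (k x)) + (1 + (r + a) * \<sigma>) * e" by (simp add: algebra_simps)
    also have "\<dots> \<le> \<rho> * (r * nP x) + \<rho> * (1 / \<eta>) * e"
    proof (rule add_mono)
      show "(r + a) * X + nH (k x) \<le> \<rho> * (r * nP x)"
        by (rule gainX) (use nonneg ka decr[of x] in \<open>simp_all add: X_def\<close>)
      show "(1 + (r + a) * \<sigma>) * e \<le> \<rho> * (1 / \<eta>) * e"
        using gaine nonneg by (intro mult_right_mono) (simp_all add: e_def)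
    qed
    also have "\<dots> = \<rho> * V (x, z)" by (simp add: V e_def algebra_simps)
    finally show ?thesis .
  qed
  have V_nonneg: "0 \<le> V s" for s using nonneg r \<eta> by (cases s) (simp add: V)

  obtain \<epsilon> where \<epsilon>: "0 < \<epsilon>" "ball 0 \<epsilon> \<subseteq> Z" using Z by (auto simp: mem_interior)
  define hinv where "hinv = mat_norm (inv_sqrt H)"
  define pinv where "pinv = mat_norm (inv_sqrt P)"
  have hinv: "0 \<le> hinv" "norm e \<le> hinv * nH e" for e
    using mat_norm_bound(1)[of "inv_sqrt H" "mat_sqrt H *v e"] mat_norm_bound(2)[of "inv_sqrt H"]
    by (simp_all add: hinv_def nH_def mat_sqrt(4)[OF H])
  have pinv: "0 \<le> pinv" "norm x \<le> pinv * nP x" for x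
    using mat_norm_bound(1)[of "inv_sqrt P" "mat_sqrt P *v x"] mat_norm_bound(2)[of "inv_sqrt P"]
    by (simp_all add: pinv_def nP_def mat_sqrt(4)[OF P])
  define \<epsilon>' where "\<epsilon>' = \<epsilon> / (hinv * a + 1)"
  have ha: "0 \<le> hinv * a" using hinv a0 by simp
  have \<epsilon>': "0 < \<epsilon>'" using \<epsilon> ha by (simp add: \<epsilon>'_def)
  have inactive: "- k x \<in> Z" if "nP x \<le> \<epsilon>'" for x
  proof -
    have "norm (- k x) \<le> hinv * nH (k x)" using hinv(2) by simp
    also have "\<dots> \<le> hinv * (a * nP x)" using ka hinv by (intro mult_left_mono) auto
    also have "\<dots> \<le> (hinv * a) * \<epsilon>'" using mult_left_mono[OF that ha] by (simp add: mult.assoc)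
    also have "\<dots> < \<epsilon>" using \<epsilon>(1) ha by (simp add: \<epsilon>'_def field_simps)
    finally show ?thesis using \<epsilon>(2) by (auto simp: dist_norm)
  qed
  have V_decr: "V (closed_loop A Bbar T s) \<le> \<rho> * V s" if "V s \<le> r * \<epsilon>'" for s
  proof (cases s)
    case (Pair x z)
    let ?x' = "A *v x + Bbar *v z"
    have "r * nP ?x' \<le> \<rho> * V s" using step[of x z] nonneg(2)[of "z + k ?x'"] unfolding Pair by linarith
    also have "\<dots> \<le> V s" using \<rho> V_nonneg[of s] mult_right_mono[of \<rho> 1 "V s"] by simp
    also have "\<dots> \<le> r * \<epsilon>'" by (rule that)
    finally have "nP ?x' \<le> \<epsilon>'" using r by simp
    then have "- k ?x' \<in> Z" by (rule inactive)
    then have "nH (T z ?x' + k ?x') \<le> \<eta> * nH (z + k ?x')" using T[of ?x' z] by (simp add: nH_def k_def)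
    then have "nH (T z ?x' + k ?x') / \<eta> \<le> nH (z + k ?x')" using \<eta>(1) by (simp add: field_simps)
    then have "V (?x', T z ?x') \<le> r * nP ?x' + nH (z + k ?x')" by (simp add: V)
    also have "\<dots> \<le> \<rho> * V s" unfolding Pair by (rule step)
    finally show ?thesis by (simp add: closed_loop_def Pair Let_def)
  qed
  \<comment> \<open>the remaining steps compare the Lyapunov function with the product distance; the summand 1 in both
    constants makes them positive\<close>
  define C1 where "C1 = (pinv + hinv * a) / r + hinv * \<eta> + 1"
  have C1: "0 < C1" using pinv hinv r \<eta> ha by (simp add: C1_def add_nonneg_pos)
  have lower: "1 / C1 * dist s (0, 0) \<le> V s" for s
  proof (cases s)
    case (Pair x z)
    define e where "e = nH (z + k x)"
    have "norm z = norm ((z + k x) + - k x)" by simp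
    also have "\<dots> \<le> norm (z + k x) + norm (- k x)" by (rule norm_triangle_ineq)
    also have "\<dots> \<le> hinv * e + hinv * nH (k x)"
      using hinv(2)[of "z + k x"] hinv(2)[of "k x"] by (simp add: e_def)
    also have "\<dots> \<le> hinv * e + hinv * (a * nP x)"
      using ka hinv by (intro add_left_mono mult_left_mono) auto
    finally have z: "norm z \<le> hinv * e + hinv * a * nP x" by simp
    have v: "nP x \<le> V s / r" "e \<le> \<eta> * V s"
      using nonneg(1)[of x] nonneg(2)[of "z + k x"] r \<eta> by (simp_all add: Pair V e_def field_simps)
    have "dist s (0, 0) = norm (x, z)" by (simp add: Pair dist_norm)
    also have "\<dots> \<le> norm x + norm z" by (rule norm_Pair_le)
    also have "\<dots> \<le> (pinv + hinv * a) * nP x + hinv * e" using z pinv(2)[of x] by (simp add: algebra_simps)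
    also have "\<dots> \<le> (pinv + hinv * a) * (V s / r) + hinv * (\<eta> * V s)"
      using v pinv(1) hinv(1) ha by (intro add_mono mult_left_mono) auto
    also have "\<dots> \<le> (pinv + hinv * a) * (V s / r) + hinv * (\<eta> * V s) + V s" using V_nonneg[of s] by simp
    also have "\<dots> = C1 * V s" by (simp add: C1_def algebra_simps add_divide_distrib)
    finally show ?thesis using C1 by (simp add: field_simps)
  qed
  define p where "p = mat_norm (mat_sqrt P)"
  define h where "h = mat_norm (mat_sqrt H)"
  have p: "0 \<le> p" "nP x \<le> p * norm x" for x unfolding p_def nP_def by (rule mat_norm_bound)+
  have h: "0 \<le> h" "nH e \<le> h * norm e" for e unfolding h_def nH_def by (rule mat_norm_bound)+
  define C2 where "C2 = r * p + (h + a * p) / \<eta> + 1"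
  have C2: "0 < C2" using r p h a0 \<eta> by (simp add: C2_def add_nonneg_pos)
  have upper: "V s \<le> C2 * dist s (0, 0)" for s
  proof (cases s)
    case (Pair x z)
    define n where "n = norm (x, z)"
    have n: "norm x \<le> n" "norm z \<le> n" "0 \<le> n"
      using norm_fst_le[of x z] norm_snd_le[of z x] by (simp_all add: n_def)
    have x: "nP x \<le> p * n" using p(2)[of x] mult_left_mono[OF n(1) p(1)] by linarith
    have "nH (z + k x) \<le> nH z + nH (k x)" by (rule nH_add)
    also have "\<dots> \<le> h * n + a * (p * n)"
      using h(2)[of z] mult_left_mono[OF n(2) h(1)] ka[of x] mult_left_mono[OF x a0(1)] by linarith
    finally have "nH (z + k x) / \<eta> \<le> (h * n + a * (p * n)) / \<eta>" using \<eta>(1) by (simp add: divide_right_mono)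
    moreover have "r * nP x \<le> r * (p * n)" using x r by simp
    ultimately have "V s \<le> r * (p * n) + (h * n + a * (p * n)) / \<eta> + n" using n(3) by (simp add: Pair V)
    also have "\<dots> = C2 * n" by (simp add: C2_def algebra_simps add_divide_distrib)
    finally show ?thesis by (simp add: n_def Pair dist_norm)
  qed
  have origin: "(0, 0) \<in> UNIV \<times> Z" using Z interior_subset by auto
  have "0 < 1 / C1" "0 < r * \<epsilon>'" using C1 r \<epsilon>' by simp_all
  then show ?thesis
    using asymptotically_stable_if_local_lyapunov[OF origin _ C2 lower upper _ \<rho> V_decr] by blast
qed

text \<open>It remains to verify the assumptions of \<open>local_closed_loop_stability\<close>. The norms of matrix products in the
  definition of \<open>\<zeta>\<^sub>a\<close> are the gains from \<open>|x|\<^sub>P\<close> to \<open>|k x|\<^sub>H\<close> and from \<open>|e|\<^sub>H\<close> to \<open>|Bbar e|\<^sub>W\<close>, and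
  \<open>|x|\<^sub>W\<^sup>2 = |x|\<^sub>P\<^sup>2 + |k x|\<^sub>H\<^sup>2\<close>, because \<open>|x|\<^sub>W\<^sup>2\<close> is the cost of zero input. Therefore the eigenvalue in
  \<open>\<beta>\<close> bounds the decrease of \<open>|x|\<^sub>P\<^sup>2\<close> by a multiple of both terms, which is the joint estimate.\<close>
theorem corollary4:
  fixes A :: "real^'n^'n" and B :: "real^'m^'n"
    and Q P W :: "real^'n^'n" and R :: "real^'m^'m"
    and U :: "(real^'m) set"
    and H :: "real^('h::{finite,linorder} \<times> 'm)^('h \<times> 'm)"
    and G :: "real^'n^('h \<times> 'm)"
    and Bbar :: "real^('h \<times> 'm)^'n"
    and Z :: "(real^('h \<times> 'm)) set"
    and \<beta> \<gamma>1 \<zeta>a la lbar :: real and l :: nat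
  assumes "stabilizable A B"
    and "pos_def R" and "pos_def Q" and "pos_def P"
    and "P = Q + transpose A ** P ** A
           - (transpose A ** P ** B) ** matrix_inv (R + transpose B ** P ** B)
               ** (transpose B ** P ** A)"
    and "closed U" and "convex U" and "0 \<in> interior U"
    and "H = H_mat A B Q R P"
    and "G = G_mat A B Q P"
    and "W = W_mat TYPE('h) A Q P"
    and "Z = input_seqs U"
    and "Bbar = B ** first_block"
    and "\<beta> = sqrt (1 - lam_min_wrt W Q)"
    and "\<gamma>1 = \<beta> / (1 - \<beta>)"
    and "\<zeta>a = 2 * mat_norm (inv_sqrt H ** G ** inv_sqrt P)
                * mat_norm (mat_sqrt W ** Bbar ** inv_sqrt H)"
    and "la = 1 - 2 * ln (sqrt (cond_num H) * (1 + \<zeta>a * \<gamma>1))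
                    / ln (1 - 1 / sqrt (cond_num H))"
    and "lbar = 1 - ln (cond_num H) / ln (1 - 1 / sqrt (cond_num H))"
    and "l > 0"
    and "real l > max la lbar"
  shows "asymptotically_stable (closed_loop A Bbar (apg H G W Z l)) (UNIV \<times> Z) (0, 0)"
proof -
  note R = \<open>pos_def R\<close> and Q = \<open>pos_def Q\<close> and P = \<open>pos_def P\<close> and ric = assms(5)
  define q where "q = quad_cost H G W"
  have psd: "0 \<le> v \<bullet> (M *v v)" if "pos_def M" for M :: "real^'k^'k" and v
    using that by (cases "v = 0") (auto simp: pos_def_def less_imp_le)
  note F = value_function_bounds[OF R P Q ric, where ?'h = 'h,
      folded \<open>H = _\<close> \<open>G = _\<close> \<open>W = _\<close> \<open>Bbar = _\<close>, folded q_def]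
  have symQ: "transpose Q = Q" and symP: "transpose P = P" using P Q by (auto simp: pos_def_def)
  have symHat: "transpose (H_hat Q P :: real^('h option \<times> 'n)^('h option \<times> 'n)) = H_hat Q P"
    by (rule H_hat_symmetric[OF symQ symP])
  have q0: "q z 0 = z \<bullet> (H *v z)" and qz0: "q 0 x = x \<bullet> (W *v x)" for z x
    by (simp_all add: q_def quad_cost_def)
  have H: "pos_def H"
  proof -
    have "transpose H = H"
    proof -
      have kron: "transpose (kron (mat 1) R) = (kron (mat 1) R :: real^('h \<times> 'm)^('h \<times> 'm))"
        using R by (intro symmetricI)
          (auto simp: inner_blocks block_kron_id pos_def_def intro!: sum.cong inner_mult_sym)
      show ?thesis
        using symHat unfolding \<open>H = _\<close> H_mat_def
        by (intro symmetricI) (simp add: matrix_vector_mult_add_rdistrib inner_add_left inner_add_right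
            inner_mult_sym[OF kron] inner_mult_sym inner_transpose_mult inner_transpose_mult'
            flip: matrix_vector_mul_assoc del: transpose_matrix_vector)
    qed
    then show ?thesis using F(4) by (simp add: pos_def_def q0)
  qed
  have symH: "transpose H = H" using H by (simp add: pos_def_def)
  have QW: "x \<bullet> (Q *v x) \<le> x \<bullet> (W *v x)" for x
    using F(2)[of x 0] psd[OF P, of "A *v x"] by (simp add: qz0)
  have W: "pos_def W"
  proof -
    have "transpose W = W"
      using symHat unfolding \<open>W = _\<close> W_mat_def
      by (intro symmetricI) (simp add: inner_mult_sym inner_transpose_mult inner_transpose_mult'
          flip: matrix_vector_mul_assoc del: transpose_matrix_vector)
    then show ?thesis using QW Q unfolding pos_def_def by (meson less_le_trans)
  qed
  define k where "k x = matrix_inv H *v (G *v x)" for x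
  have Hk: "H *v k x = G *v x" for x by (simp add: k_def pos_def_inv_cancel(2)[OF H])
  have q_expand: "q z x = q (- k x) x + (z + k x) \<bullet> (H *v (z + k x))" for z x
  proof -
    have "H *v (- k x) = - (G *v x)"
      using matrix_vector_mult_diff_distrib[of H 0 "k x"] by (simp add: Hk)
    then show ?thesis using quad_cost_expand[OF symH, of G W z x "- k x"] by (simp add: q_def)
  qed
  \<comment> \<open>the minimal cost is \<open>|x|\<^sub>P\<^sup>2\<close>, as it is attained by the linear-quadratic regulator\<close>
  have qk: "q (- k x) x = x \<bullet> (P *v x)" for x
  proof -
    obtain z where "q z x = x \<bullet> (P *v x)" using F(3)[of x] by blast
    then show ?thesis using q_expand[of z x] F(1)[of x "- k x"] psd[OF H, of "z + k x"] by linarith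
  qed
  have WPk: "x \<bullet> (W *v x) = x \<bullet> (P *v x) + k x \<bullet> (H *v k x)" for x
    using q_expand[of 0 x] by (simp add: qz0 qk)
  note sqP = mat_sqrt(3)[OF P] and sqH = mat_sqrt(3)[OF H] and sqW = mat_sqrt(3)[OF W]
  define \<nu> where "\<nu> = lam_min_wrt W Q"
  note lam = lam_min_wrt_bound[OF W Q QW, folded \<nu>_def]
  have \<beta>2: "\<beta>\<^sup>2 = 1 - \<nu>" and \<beta>: "0 \<le> \<beta>" "\<beta> < 1"
    using lam(2,3) \<open>\<beta> = _\<close> by (simp_all add: \<nu>_def)
  define a where "a = mat_norm (inv_sqrt H ** G ** inv_sqrt P)"
  define \<sigma> where "\<sigma> = mat_norm (mat_sqrt W ** Bbar ** inv_sqrt H)"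
  have a\<sigma>: "0 \<le> a" "0 \<le> \<sigma>" unfolding a_def \<sigma>_def by (rule mat_norm_bound)+
  have c1: "1 \<le> 1 + \<zeta>a * \<gamma>1" and c: "1 + 2 * a * \<sigma> * (\<beta> / (1 - \<beta>)) = 1 + \<zeta>a * \<gamma>1"
    using a\<sigma> \<beta> \<open>\<zeta>a = _\<close> \<open>\<gamma>1 = _\<close> by (simp_all add: a_def \<sigma>_def)
  note Zf = input_seqs_regular[OF \<open>closed U\<close> \<open>convex U\<close> \<open>0 \<in> interior U\<close>, where ?'h = 'h, folded \<open>Z = _\<close>]

  define \<kappa> where "\<kappa> = cond_num H"
  have \<kappa>: "1 \<le> \<kappa>" using pos_def_lam[OF H] by (simp add: \<kappa>_def cond_num_def)
  have qnonneg: "0 \<le> quad_cost H G W z x" for z x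
    using F(1)[of x z] psd[OF P, of x] by (simp add: q_def)
  have zs: "H *v (- k x) + G *v x = 0" for x
    using matrix_vector_mult_diff_distrib[of H 0 "k x"] by (simp add: Hk)
  obtain \<eta> where \<eta>: "0 < \<eta>" "\<eta> * (7/5 * (1 + \<zeta>a * \<gamma>1)) < 1"
    and T: "\<And>z x. - k x \<in> Z \<Longrightarrow>
      norm (mat_sqrt H *v (apg H G W Z l z x + k x)) \<le> \<eta> * norm (mat_sqrt H *v (z + k x))"
  proof (cases "\<kappa> = 1")
    case True
    show ?thesis
    \<comment> \<open>the optimizer is exact, so any sufficiently small positive number is a contraction factor\<close>
    proof (rule that[of "1 / (7/5 * (1 + \<zeta>a * \<gamma>1) + 1)"])
      fix z x assume "- k x \<in> Z"
      then have "apg H G W Z l z x = - k x"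
        using apg_contraction(1)[OF H Zf(2,1) _ zs qnonneg] True \<open>l > 0\<close> by (simp add: \<kappa>_def)
      then show "norm (mat_sqrt H *v (apg H G W Z l z x + k x))
          \<le> 1 / (7/5 * (1 + \<zeta>a * \<gamma>1) + 1) * norm (mat_sqrt H *v (z + k x))"
        using c1 by simp
    qed (use c1 in \<open>simp_all add: field_simps\<close>)
  next
    case False
    then have \<kappa>1: "1 < \<kappa>" using \<kappa> by simp
    have "1 - 2 * ln (sqrt \<kappa> * (1 + \<zeta>a * \<gamma>1)) / ln (1 - 1 / sqrt \<kappa>) < real l"
      using \<open>real l > max la lbar\<close> \<open>la = _\<close> by (simp add: \<kappa>_def)
    note l = iteration_bound_power[OF \<kappa>1 c1 this]
    define t where "t = (1 - 1 / sqrt \<kappa>) ^ (l - 1) * (\<kappa> / 2)"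
    have t: "0 < t" using \<kappa>1 by (simp add: t_def)
    show ?thesis
    proof (rule that[of "sqrt t"])
      show "0 < sqrt t" using t by simp
      show "sqrt t * (7/5 * (1 + \<zeta>a * \<gamma>1)) < 1"
      proof (rule power2_less_imp_less)
        have sq: "(7/5 * y)\<^sup>2 = 49/25 * y\<^sup>2" for y :: real by (simp add: power2_eq_square)
        have "(sqrt t * (7/5 * (1 + \<zeta>a * \<gamma>1)))\<^sup>2 = t * (49/25 * (1 + \<zeta>a * \<gamma>1)\<^sup>2)"
          using t by (simp only: power_mult_distrib[of "sqrt t"] sq real_sqrt_pow2[OF less_imp_le])
        also have "\<dots> = 49/50 * ((1 - 1 / sqrt \<kappa>) ^ (l - 1) * \<kappa> * (1 + \<zeta>a * \<gamma>1)\<^sup>2)"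
          by (simp add: t_def)
        also have "\<dots> < 49/50 * 1" using l(2) by (intro mult_strict_left_mono) auto
        finally show "(sqrt t * (7/5 * (1 + \<zeta>a * \<gamma>1)))\<^sup>2 < 1\<^sup>2" by simp
      qed simp
      fix z x assume "- k x \<in> Z"
      from apg_contraction(2)[OF H Zf(2,1) this zs qnonneg \<kappa>1[unfolded \<kappa>_def] l(1), of z]
      have "(norm (mat_sqrt H *v (apg H G W Z l z x + k x)))\<^sup>2 \<le> t * (norm (mat_sqrt H *v (z + k x)))\<^sup>2"
        unfolding sqH t_def \<kappa>_def diff_minus_eq_add .
      also have "\<dots> = (sqrt t * norm (mat_sqrt H *v (z + k x)))\<^sup>2" using t by (simp add: power_mult_distrib)
      finally show "norm (mat_sqrt H *v (apg H G W Z l z x + k x)) \<le> sqrt t * norm (mat_sqrt H *v (z + k x))"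
        by (rule power2_le_imp_le) (use t in simp)
    qed
  qed
  show ?thesis
  proof (rule local_closed_loop_stability[OF H P Zf(3) \<beta> a\<sigma>(1) _ a\<sigma>(2) _ _ _ \<eta>(1)])
    show "\<eta> * (7/5 * (1 + 2 * a * \<sigma> * (\<beta> / (1 - \<beta>)))) < 1" unfolding c by (rule \<eta>(2))
    show "norm (mat_sqrt H *v (apg H G W Z l z x + matrix_inv H *v (G *v x)))
        \<le> \<eta> * norm (mat_sqrt H *v (z + matrix_inv H *v (G *v x)))"
      if "- (matrix_inv H *v (G *v x)) \<in> Z" for z x
      using T[of x z] that by (simp add: k_def)
    show "norm (mat_sqrt H *v (matrix_inv H *v (G *v x))) \<le> a * norm (mat_sqrt P *v x)" for x
    proof -
      have "mat_sqrt H *v (k x) = inv_sqrt H *v (H *v k x)"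
        by (metis mat_sqrt(2,4)[OF H] matrix_vector_mul_assoc)
      also have "\<dots> = (inv_sqrt H ** G ** inv_sqrt P) *v (mat_sqrt P *v x)"
        by (simp add: Hk mat_sqrt(4)[OF P] flip: matrix_vector_mul_assoc)
      finally show ?thesis using mat_norm_bound(1) by (simp add: k_def a_def)
    qed
    show "norm (mat_sqrt P *v (Bbar *v e)) \<le> \<sigma> * norm (mat_sqrt H *v e)" for e
    proof -
      have "norm (mat_sqrt P *v (Bbar *v e)) \<le> norm (mat_sqrt W *v (Bbar *v e))"
        by (rule power2_le_imp_le) (simp_all add: sqP sqW WPk psd[OF H])
      also have "mat_sqrt W *v (Bbar *v e) = (mat_sqrt W ** Bbar ** inv_sqrt H) *v (mat_sqrt H *v e)"
        by (simp add: mat_sqrt(4)[OF H] flip: matrix_vector_mul_assoc)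
      also have "norm \<dots> \<le> \<sigma> * norm (mat_sqrt H *v e)" unfolding \<sigma>_def by (rule mat_norm_bound)
      finally show ?thesis .
    qed
    show "norm (mat_sqrt P *v (Bbar *v e)) \<le> norm (mat_sqrt H *v e)" for e
      by (rule power2_le_imp_le) (use F(2)[of 0 e] in \<open>simp_all add: sqP sqH q0\<close>)
    show "(norm (mat_sqrt P *v (A *v x - Bbar *v (matrix_inv H *v (G *v x)))))\<^sup>2
        + (1 - \<beta>\<^sup>2) * (norm (mat_sqrt H *v (matrix_inv H *v (G *v x))))\<^sup>2
      \<le> \<beta>\<^sup>2 * (norm (mat_sqrt P *v x))\<^sup>2" for x
    proof -
      have "A *v x + Bbar *v (- k x) = A *v x - Bbar *v k x"
        using matrix_vector_mult_diff_distrib[of Bbar 0 "k x"] by simp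
      then have "x \<bullet> (Q *v x) + (norm (mat_sqrt P *v (A *v x - Bbar *v k x)))\<^sup>2 \<le> (norm (mat_sqrt P *v x))\<^sup>2"
        using F(2)[of x "- k x"] by (simp add: qk sqP)
      moreover have "\<nu> * ((norm (mat_sqrt P *v x))\<^sup>2 + (norm (mat_sqrt H *v k x))\<^sup>2) \<le> x \<bullet> (Q *v x)"
        using lam(1)[of x] by (simp add: WPk sqP sqH)
      ultimately show ?thesis unfolding k_def[symmetric] \<beta>2 by (simp add: algebra_simps)
    qed
  qed
qed

end
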